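(* Let $\mathbf{Z}=(\mathbf{L},A,Y)\sim P$ and let $$\psi=\int_{\mathcal{A}}\int_{\mathcal{L}}\mu(\mathbf{l},a)\,\varpi(a)\,dP(\mathbf{l})\,da .$$ Under a nonparametric model, the efficient influence function for $\psi$ is $$\xi(\mathbf{Z};\pi,\mu)-\psi+\int_{\mathcal{A}}\Big\{\mu(\mathbf{L},a)-\int_{\mathcal{L}}\mu(\mathbf{l},a)\,dP(\mathbf{l})\Big\}\varpi(a)\,da,$$ where $$\xi(\mathbf{Z};\pi,\mu)=\frac{Y-\mu(\mathbf{L},A)}{\pi(A\mid\mathbf{L})}\int_{\mathcal{L}}\pi(A\mid\mathbf{l})\,dP(\mathbf{l})+\int_{\mathcal{L}}\mu(\mathbf{l},A)\,dP(\mathbf{l}).$$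
   Context: Data: $\mathbf{Z}=(\mathbf{L},A,Y)$ has distribution $P$ and support $\mathcal{Z}=\mathcal{L}\times\mathcal{A}\times\mathcal{Y}$, where $\mathbf{L}$ is a vector of covariates, $A$ a continuous treatment or exposure, and $Y$ an outcome. $P$ has density $p(\mathbf{z})=p(y\mid\mathbf{l},a)\,p(a\mid\mathbf{l})\,p(\mathbf{l})$ with respect to some dominating measure. $dP(\mathbf{l})$ denotes integration with respect to the marginal law of $\mathbf{L}$. Notation: $\mu(\mathbf{l},a)=\mathbb{E}(Y\mid\mathbf{L}=\mathbf{l},A=a)$ is the mean outcome given covariates and treatment; $\pi(a\mid\mathbf{l})=\frac{\partial}{\partial a}P(A\le a\mid\mathbf{L}=\mathbf{l})$ is the conditional treatment density given covariates; $\varpi(a)=\frac{\partial}{\partial a}P(A\le a)=\int_{\mathcal{L}}\pi(a\mid\mathbf{l})\,dP(\mathbf{l})$ is the marginal treatment density. In the nonparametric model the marginal density $\varpi$ is unknown, so it is part of what varies when $P$ varies. Efficient influence function: this is meant in the usual sense of semiparametric theory. Consider parametric submodels $p(\mathbf{z};\epsilon)$ with $\epsilon\in\mathbb{R}$ and $p(\mathbf{z};0)=p(\mathbf{z})$ (for example $p(\mathbf{z};\epsilon)=\{1+\epsilon b(\mathbf{z})\}p(\mathbf{z})$ with $\mathbb{E}\{b(\mathbf{Z})\}=0$, $|b(\mathbf{Z})|<B$, $|\epsilon|\le 1/B$), with score $\ell'_\epsilon(\mathbf{z};0)=\frac{\partial}{\partial\epsilon}\log p(\mathbf{z};\epsilon)\big|_{\epsilon=0}$,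 and let $\psi(\epsilon)$ be the parameter $\psi$ viewed as a functional on the submodel (with $\mu$, $\varpi$ and the law of $\mathbf{L}$ all those of $p(\cdot;\epsilon)$). The efficient influence function for $\psi$ is the unique mean-zero function $\phi(\mathbf{Z})$ satisfying $\psi'_\epsilon(0)=\mathbb{E}\{\phi(\mathbf{Z})\,\ell'_\epsilon(\mathbf{Z};0)\}$, where $\psi'_\epsilon(0)=\frac{\partial}{\partial\epsilon}\psi(\epsilon)\big|_{\epsilon=0}$. *)

theory Defs
  imports "HOL-Probability.Probability"
begin

section \<open>The data distribution\<close>

text \<open>
  An observation is \<open>z = (l, a, y)\<close>.  Its law is given by a density \<open>p\<close> with respect to
  \<open>NL \<Otimes> Lebesgue on AA \<Otimes> NY\<close>.  The covariates take values in an arbitrary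
  measurable space, so vectors of any dimension, with discrete or continuous components, are
  covered through the choice of \<open>NL\<close>; likewise \<open>NY\<close> allows discrete and continuous
  outcomes.  The treatment is continuous, hence Lebesgue measure on the treatment set \<open>AA\<close>.
\<close>

abbreviation leb_on :: "real set \<Rightarrow> real measure" where
  "leb_on AA \<equiv> restrict_space lborel AA"

definition dominating ::
  "'l measure \<Rightarrow> real set \<Rightarrow> real measure \<Rightarrow> ('l \<times> real \<times> real) measure" where
  "dominating NL AA NY = NL \<Otimes>\<^sub>M (leb_on AA \<Otimes>\<^sub>M NY)"

definition prob_density :: "'z measure \<Rightarrow> ('z \<Rightarrow> real) \<Rightarrow> bool" where
  "prob_density M p \<longleftrightarrow>
     p \<in> borel_measurable M \<and> (\<forall>z\<in>space M. 0 \<le> p z) \<and> (\<integral>\<^sup>+ z. ennreal (p z) \<partial>M) = 1"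

definition law :: "'z measure \<Rightarrow> ('z \<Rightarrow> real) \<Rightarrow> 'z measure" where
  "law M p = density M (\<lambda>z. ennreal (p z))"

definition covariate_law ::
  "'l measure \<Rightarrow> real set \<Rightarrow> real measure \<Rightarrow> ('l \<times> real \<times> real \<Rightarrow> real) \<Rightarrow> 'l measure" where
  "covariate_law NL AA NY p = distr (law (dominating NL AA NY) p) NL fst"

text \<open>
  The factors of \<open>p(l,a,y) = p(y | l,a) p(a | l) p(l)\<close>.  The second factor,
  \<open>treatment_density\<close>, is the conditional Lebesgue density of the treatment, that is, the
  (almost everywhere) derivative of \<open>a \<mapsto> P(A \<le> a | L = l)\<close>.
\<close>

definition outcome_density ::
  "real measure \<Rightarrow> ('l \<times> real \<times> real \<Rightarrow> real) \<Rightarrow> 'l \<Rightarrow> real \<Rightarrow> real \<Rightarrow> real" where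
  "outcome_density NY p l a y = p (l, a, y) / (\<integral>y'. p (l, a, y') \<partial>NY)"

definition treatment_density ::
  "real set \<Rightarrow> real measure \<Rightarrow> ('l \<times> real \<times> real \<Rightarrow> real) \<Rightarrow> 'l \<Rightarrow> real \<Rightarrow> real" where
  "treatment_density AA NY p l a =
     (\<integral>y. p (l, a, y) \<partial>NY) / (\<integral>a'. (\<integral>y. p (l, a', y) \<partial>NY) \<partial>leb_on AA)"

definition outcome_mean ::
  "real measure \<Rightarrow> ('l \<times> real \<times> real \<Rightarrow> real) \<Rightarrow> 'l \<Rightarrow> real \<Rightarrow> real" where
  "outcome_mean NY p l a = (\<integral>y. y * outcome_density NY p l a y \<partial>NY)"

definition marginal_treatment_density ::
  "'l measure \<Rightarrow> real set \<Rightarrow> real measure \<Rightarrow> ('l \<times> real \<times> real \<Rightarrow> real) \<Rightarrow> real \<Rightarrow> real" where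
  "marginal_treatment_density NL AA NY p a =
     (\<integral>l. treatment_density AA NY p l a \<partial>covariate_law NL AA NY p)"

section \<open>The parameter and the candidate influence function\<close>

text \<open>The parameter is a functional of the whole density: all three nuisance components and the
  covariate law are those of the density it is evaluated at.\<close>

definition psi ::
  "'l measure \<Rightarrow> real set \<Rightarrow> real measure \<Rightarrow> ('l \<times> real \<times> real \<Rightarrow> real) \<Rightarrow> real" where
  "psi NL AA NY p =
     (\<integral>a. (\<integral>l. outcome_mean NY p l a * marginal_treatment_density NL AA NY p a
              \<partial>covariate_law NL AA NY p) \<partial>leb_on AA)"

definition xi ::
  "'l measure \<Rightarrow> ('l \<Rightarrow> real \<Rightarrow> real) \<Rightarrow> ('l \<Rightarrow> real \<Rightarrow> real) \<Rightarrow> 'l \<times> real \<times> real \<Rightarrow> real" where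
  "xi PL \<pi> \<mu> = (\<lambda>(l, a, y).
     (y - \<mu> l a) / \<pi> l a * (\<integral>l'. \<pi> l' a \<partial>PL) + (\<integral>l'. \<mu> l' a \<partial>PL))"

section \<open>Parametric submodels and efficient influence functions\<close>

text \<open>
  A parametric submodel is a path \<open>q\<close> of densities through \<open>p\<close>, defined for small parameter
  values, that is differentiable at \<open>0\<close> with a bounded score.  Bounding the likelihood ratio as
  below is the usual regularity condition; the paths \<open>(1 + \<epsilon> b) p\<close> with bounded
  mean-zero \<open>b\<close> satisfy it, but the path may depend nonlinearly on the parameter.
\<close>

definition parametric_submodel ::
  "'z measure \<Rightarrow> ('z \<Rightarrow> real) \<Rightarrow> (real \<Rightarrow> 'z \<Rightarrow> real) \<Rightarrow> bool" where
  "parametric_submodel M p q \<longleftrightarrow>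
     (\<forall>z\<in>space M. q 0 z = p z) \<and>
     (\<forall>z\<in>space M. (\<lambda>\<epsilon>. q \<epsilon> z) differentiable (at 0)) \<and>
     (\<exists>\<delta>>0. \<exists>B. \<forall>\<epsilon>. \<bar>\<epsilon>\<bar> < \<delta> \<longrightarrow>
        prob_density M (q \<epsilon>) \<and> (\<forall>z\<in>space M. \<bar>q \<epsilon> z - p z\<bar> \<le> B * \<bar>\<epsilon>\<bar> * p z))"

definition score :: "(real \<Rightarrow> 'z \<Rightarrow> real) \<Rightarrow> 'z \<Rightarrow> real" where
  "score q z = deriv (\<lambda>\<epsilon>. ln (q \<epsilon> z)) 0"

definition influence_function ::
  "'z measure \<Rightarrow> ('z \<Rightarrow> real) \<Rightarrow> (('z \<Rightarrow> real) \<Rightarrow> real) \<Rightarrow> ('z \<Rightarrow> real) \<Rightarrow> bool" where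
  "influence_function M p \<Psi> \<phi> \<longleftrightarrow>
     integrable (law M p) \<phi> \<and> (\<integral>z. \<phi> z \<partial>law M p) = 0 \<and>
     (\<forall>q. parametric_submodel M p q \<longrightarrow>
        ((\<lambda>\<epsilon>. \<Psi> (q \<epsilon>)) has_real_derivative (\<integral>z. \<phi> z * score q z \<partial>law M p)) (at 0))"

text \<open>Uniqueness is almost sure, and is part of the definition.\<close>

definition efficient_influence_function ::
  "'z measure \<Rightarrow> ('z \<Rightarrow> real) \<Rightarrow> (('z \<Rightarrow> real) \<Rightarrow> real) \<Rightarrow> ('z \<Rightarrow> real) \<Rightarrow> bool" where
  "efficient_influence_function M p \<Psi> \<phi> \<longleftrightarrow>
     influence_function M p \<Psi> \<phi> \<and>
     (\<forall>\<phi>'. influence_function M p \<Psi> \<phi>' \<longrightarrow> (AE z in law M p. \<phi>' z = \<phi> z))"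

lemma linear_parametric_submodel:
  fixes M :: "'z measure" and b p :: "'z \<Rightarrow> real"
  assumes p: "prob_density M p" and b: "b \<in> borel_measurable M"
    and bound: "\<And>z. z \<in> space M \<Longrightarrow> \<bar>b z\<bar> < B" and B: "B > 0"
    and mean: "(\<integral>z. b z \<partial>law M p) = 0"
  shows "parametric_submodel M p (\<lambda>\<epsilon> z. (1 + \<epsilon> * b z) * p z)"
proof -
  have pm: "p \<in> borel_measurable M" and p0: "\<And>z. z \<in> space M \<Longrightarrow> 0 \<le> p z"
    and p1: "(\<integral>\<^sup>+ z. ennreal (p z) \<partial>M) = 1"
    using p by (auto simp: prob_density_def)
  have ip: "integrable M p"
    using pm p0 p1 by (intro integrableI_nonneg) auto
  have p1': "(\<integral>z. p z \<partial>M) = 1"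
    using pm p0 p1 by (subst integral_eq_nn_integral) auto
  have ib: "integrable M (\<lambda>z. b z * p z)"
  proof (rule Bochner_Integration.integrable_bound[where f = "\<lambda>z. B * p z"])
    show "AE z in M. norm (b z * p z) \<le> norm (B * p z)"
    proof (rule AE_I2)
      fix z assume "z \<in> space M"
      then show "norm (b z * p z) \<le> norm (B * p z)"
        using bound[of z] p0[of z] B by (simp add: abs_mult mult_right_mono)
    qed
  qed (use ip pm b in auto)
  have ib0: "(\<integral>z. b z * p z \<partial>M) = 0"
    using mean pm p0 b unfolding law_def
    by (subst (asm) integral_density) (auto simp: mult.commute)
  have dens: "prob_density M (\<lambda>z. (1 + \<epsilon> * b z) * p z)" if e: "\<bar>\<epsilon>\<bar> < 1 / B" for \<epsilon>
  proof -
    have nn: "0 \<le> (1 + \<epsilon> * b z) * p z" if z: "z \<in> space M" for z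
    proof -
      have "\<bar>\<epsilon> * b z\<bar> \<le> 1 / B * B"
        unfolding abs_mult using e bound[OF z] B by (intro mult_mono) auto
      then have "0 \<le> 1 + \<epsilon> * b z" using B by auto
      then show ?thesis using p0[OF z] by simp
    qed
    have i: "integrable M (\<lambda>z. p z + \<epsilon> * (b z * p z))"
      using ip ib by auto
    have "(\<integral>z. p z + \<epsilon> * (b z * p z) \<partial>M) = 1"
      using ip ib p1' ib0 by simp
    then have "(\<integral>\<^sup>+ z. ennreal (p z + \<epsilon> * (b z * p z)) \<partial>M) = 1"
      using i nn by (subst nn_integral_eq_integral) (auto simp: algebra_simps)
    then show ?thesis
      using nn pm b by (auto simp: prob_density_def algebra_simps)
  qed
  have ratio: "\<bar>(1 + \<epsilon> * b z) * p z - p z\<bar> \<le> B * \<bar>\<epsilon>\<bar> * p z"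
    if z: "z \<in> space M" for \<epsilon> z
  proof -
    have "\<bar>(1 + \<epsilon> * b z) * p z - p z\<bar> = \<bar>\<epsilon> * b z * p z\<bar>"
      by (simp add: algebra_simps)
    also have "\<dots> = \<bar>b z\<bar> * \<bar>\<epsilon>\<bar> * p z"
      using p0[OF z] by (simp add: abs_mult)
    also have "\<dots> \<le> B * \<bar>\<epsilon>\<bar> * p z"
      using bound[OF z] p0[OF z] by (intro mult_right_mono) auto
    finally show ?thesis .
  qed
  have "\<exists>\<delta>>0. \<exists>B. \<forall>\<epsilon>. \<bar>\<epsilon>\<bar> < \<delta> \<longrightarrow>
      prob_density M (\<lambda>z. (1 + \<epsilon> * b z) * p z) \<and>
      (\<forall>z\<in>space M. \<bar>(1 + \<epsilon> * b z) * p z - p z\<bar> \<le> B * \<bar>\<epsilon>\<bar> * p z)"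
    by (rule exI[of _ "1 / B"], intro conjI exI[of _ B]) (use dens ratio B in auto)
  then show ?thesis
    unfolding parametric_submodel_def by simp
qed

lemma score_linear:
  assumes "p z > (0::real)"
  shows "score (\<lambda>\<epsilon> z. (1 + \<epsilon> * b z) * p z) z = b z"
proof -
  have "((\<lambda>\<epsilon>. ln ((1 + \<epsilon> * b z) * p z)) has_real_derivative b z) (at 0)"
    using assms by (auto intro!: derivative_eq_intros)
  then show ?thesis
    unfolding score_def by (rule DERIV_imp_deriv)
qed

end

theory Submission
  imports Defs
begin

text \<open>
  Write \<open>f(l,a)\<close>, \<open>g(l)\<close>, \<open>w(a)\<close> for the joint density of covariates and treatment and its two
  marginals.  Then \<open>\<psi>(p)\<close> is the integral of \<open>y p g w / f\<close>.  Along a submodel each of \<open>p\<close>, \<open>f\<close>, \<open>g\<close>,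
  \<open>w\<close> changes by a relative amount \<open>O(\<epsilon>)\<close>, uniformly in the data, and so does \<open>p g w / f\<close>; hence
  dominated convergence and the product rule give \<open>\<psi>'\<close> as a sum of four integrals, one for each factor.
  Fubini's theorem turns each of them into an integral of the derivative of \<open>p\<close>, which is score times
  \<open>p\<close>, against a function of the data: \<open>y g w / f\<close> for \<open>p\<close>, \<open>-\<mu> g w / f\<close> for \<open>f\<close>, the integral of
  \<open>\<mu> w da\<close> for \<open>g\<close>, and that of \<open>\<mu> dP(l)\<close> for \<open>w\<close>.  Their sum minus \<open>2 \<psi>\<close> is the influence function.
\<close>

section \<open>Paths of functions with relative Lipschitz dependence on the parameter\<close>

text \<open>The obstacle is that nothing is bounded away from zero: conditional densities are
  quotients whose denominators may vanish, and marginals are Bochner integrals of sections that may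
  fail to be integrable. Measuring the change relative to the value at 0 deals with both. A zero of
  \<open>u 0\<close> remains a zero of \<open>u \<epsilon>\<close> for all small \<epsilon>, so it
  is harmless under the convention x / 0 = 0; and \<open>u \<epsilon>\<close> has integrable
  sections exactly where \<open>u 0\<close> has, so the default value 0 of a divergent integral is
  stable too. Paths of this kind are therefore closed under products, quotients and partial
  integration. Beyond integrability of the densities themselves, only that of the outcome times p g
  w / f is required, which is what a finite mean says. The constant 2 \<psi> comes from homogeneity:
  p g w / f has degree 3 - 1 = 2 in p, so by Euler's identity the four terms have total mean 2
  \<psi>. Subtracting a constant changes nothing against scores, which have mean zero.\<close>

definition tame_path :: "'z measure \<Rightarrow> (real \<Rightarrow> 'z \<Rightarrow> real) \<Rightarrow> bool" where
  "tame_path M u \<longleftrightarrow>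
     (\<forall>z\<in>space M. 0 \<le> u 0 z \<and> (\<lambda>\<epsilon>. u \<epsilon> z) differentiable (at 0)) \<and>
     (\<exists>B\<ge>0. \<forall>\<^sub>F \<epsilon> in nhds 0. u \<epsilon> \<in> borel_measurable M \<and>
        (\<forall>z\<in>space M. \<bar>u \<epsilon> z - u 0 z\<bar> \<le> B * \<bar>\<epsilon>\<bar> * u 0 z))"

definition path_deriv :: "(real \<Rightarrow> 'z \<Rightarrow> real) \<Rightarrow> 'z \<Rightarrow> real" where
  "path_deriv u z = deriv (\<lambda>\<epsilon>. u \<epsilon> z) 0"

lemma tame_pathI:
  assumes "\<And>z. z \<in> space M \<Longrightarrow> 0 \<le> u 0 z"
    and "\<And>z. z \<in> space M \<Longrightarrow> (\<lambda>\<epsilon>. u \<epsilon> z) differentiable (at 0)"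
    and "B \<ge> 0"
    and "\<forall>\<^sub>F \<epsilon> in nhds 0. u \<epsilon> \<in> borel_measurable M \<and>
        (\<forall>z\<in>space M. \<bar>u \<epsilon> z - u 0 z\<bar> \<le> B * \<bar>\<epsilon>\<bar> * u 0 z)"
  shows "tame_path M u"
  using assms unfolding tame_path_def by blast

lemma tame_pathE:
  assumes "tame_path M u"
  obtains B where "B \<ge> 0"
    and "\<forall>\<^sub>F \<epsilon> in nhds 0. u \<epsilon> \<in> borel_measurable M \<and>
        (\<forall>z\<in>space M. \<bar>u \<epsilon> z - u 0 z\<bar> \<le> B * \<bar>\<epsilon>\<bar> * u 0 z)"
  using assms unfolding tame_path_def by blast

lemma tame_path_nonneg: "tame_path M u \<Longrightarrow> z \<in> space M \<Longrightarrow> 0 \<le> u 0 z"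
  unfolding tame_path_def by blast

text \<open>The eventual condition is taken in \<open>nhds 0\<close> and not in \<open>at 0\<close>,
  so it covers the parameter value 0 itself.\<close>

lemma tame_path_measurable: "tame_path M u \<Longrightarrow> u 0 \<in> borel_measurable M"
  by (metis (no_types, lifting) tame_pathE eventually_nhds_x_imp_x)

lemma tame_path_has_deriv:
  assumes "tame_path M u" "z \<in> space M"
  shows "((\<lambda>\<epsilon>. u \<epsilon> z) has_real_derivative path_deriv u z) (at 0)"
  using assms unfolding tame_path_def path_deriv_def
  by (metis DERIV_deriv_iff_real_differentiable)

lemma eventually_abs_small:
  fixes d :: real assumes "d > 0"
  shows "\<forall>\<^sub>F \<epsilon> in nhds 0. \<bar>\<epsilon>\<bar> < d"
  using assms by (auto simp: eventually_nhds_metric dist_real_def)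

text \<open>A relative change of at most 1/2 keeps \<open>u \<epsilon>\<close> between
  \<open>u 0 / 2\<close> and \<open>2 * u 0\<close>. Inverses and integrability arguments rest on
  this two-sided comparison.\<close>

lemma eventually_lipschitz_small:
  fixes B :: real
  assumes "B \<ge> 0"
  shows "\<forall>\<^sub>F \<epsilon> in nhds 0. \<bar>\<epsilon>\<bar> < 1 \<and> B * \<bar>\<epsilon>\<bar> \<le> 1 / 2"
proof -
  \<comment> \<open>The 1 added to B keeps the radius positive when B = 0 and also yields the bound
    on \<epsilon> alone.\<close>
  have "\<forall>\<^sub>F \<epsilon> in nhds 0. \<bar>\<epsilon>\<bar> < 1 / (2 * (B + 1))"
    using assms by (intro eventually_abs_small) auto
  then show ?thesis
  proof eventually_elim
    case (elim \<epsilon>)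
    have "\<bar>\<epsilon>\<bar> * (2 * (B + 1)) < 1"
      using elim assms by (simp add: field_simps)
    then have "2 * (B * \<bar>\<epsilon>\<bar>) + 2 * \<bar>\<epsilon>\<bar> < 1" by (simp add: algebra_simps)
    moreover have "0 \<le> B * \<bar>\<epsilon>\<bar>" using assms by simp
    ultimately show ?case by linarith
  qed
qed

lemma tame_path_mult:
  assumes u: "tame_path M u" and v: "tame_path M v"
  shows "tame_path M (\<lambda>\<epsilon> z. u \<epsilon> z * v \<epsilon> z)"
proof -
  obtain B where B: "B \<ge> 0" "\<forall>\<^sub>F \<epsilon> in nhds 0. u \<epsilon> \<in> borel_measurable M \<and>
        (\<forall>z\<in>space M. \<bar>u \<epsilon> z - u 0 z\<bar> \<le> B * \<bar>\<epsilon>\<bar> * u 0 z)"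
    using u by (rule tame_pathE)
  obtain C where C: "C \<ge> 0" "\<forall>\<^sub>F \<epsilon> in nhds 0. v \<epsilon> \<in> borel_measurable M \<and>
        (\<forall>z\<in>space M. \<bar>v \<epsilon> z - v 0 z\<bar> \<le> C * \<bar>\<epsilon>\<bar> * v 0 z)"
    using v by (rule tame_pathE)
  show ?thesis
  proof (rule tame_pathI)
    show "0 \<le> u 0 z * v 0 z" if "z \<in> space M" for z
      using tame_path_nonneg[OF u that] tame_path_nonneg[OF v that] by simp
    show "(\<lambda>\<epsilon>. u \<epsilon> z * v \<epsilon> z) differentiable (at 0)" if "z \<in> space M" for z
      using u v that unfolding tame_path_def by (intro differentiable_mult) auto
    \<comment> \<open>The increment splits as (u \<epsilon> - u 0) v \<epsilon> + u 0 (v \<epsilon>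
      - v 0). For small \<epsilon> the factor v \<epsilon> is at most 2 v 0, hence the 2 in front of
      B.\<close>
    show "0 \<le> 2 * B + C" using B C by simp
    show "\<forall>\<^sub>F \<epsilon> in nhds 0. (\<lambda>z. u \<epsilon> z * v \<epsilon> z) \<in> borel_measurable M \<and>
      (\<forall>z\<in>space M. \<bar>u \<epsilon> z * v \<epsilon> z - u 0 z * v 0 z\<bar> \<le> (2 * B + C) * \<bar>\<epsilon>\<bar> * (u 0 z * v 0 z))"
      using B(2) C(2) eventually_lipschitz_small[OF C(1)]
    proof eventually_elim
      case (elim \<epsilon>)
      have "\<bar>u \<epsilon> z * v \<epsilon> z - u 0 z * v 0 z\<bar> \<le> (2 * B + C) * \<bar>\<epsilon>\<bar> * (u 0 z * v 0 z)"
        if z: "z \<in> space M" for z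
      proof -
        have u0: "0 \<le> u 0 z" and v0: "0 \<le> v 0 z"
          using tame_path_nonneg[OF u z] tame_path_nonneg[OF v z] by auto
        have du: "\<bar>u \<epsilon> z - u 0 z\<bar> \<le> B * \<bar>\<epsilon>\<bar> * u 0 z"
          and dv: "\<bar>v \<epsilon> z - v 0 z\<bar> \<le> C * \<bar>\<epsilon>\<bar> * v 0 z" using elim z by auto
        have "C * \<bar>\<epsilon>\<bar> * v 0 z \<le> 1 * v 0 z"
          using elim v0 by (intro mult_right_mono) auto
        then have v2: "\<bar>v \<epsilon> z\<bar> \<le> 2 * v 0 z" using dv v0 by linarith
        have "u \<epsilon> z * v \<epsilon> z - u 0 z * v 0 z =
            (u \<epsilon> z - u 0 z) * v \<epsilon> z + u 0 z * (v \<epsilon> z - v 0 z)"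
          by (simp add: algebra_simps)
        then have "\<bar>u \<epsilon> z * v \<epsilon> z - u 0 z * v 0 z\<bar> \<le>
            \<bar>u \<epsilon> z - u 0 z\<bar> * \<bar>v \<epsilon> z\<bar> + u 0 z * \<bar>v \<epsilon> z - v 0 z\<bar>"
          using u0 by (metis abs_mult abs_of_nonneg abs_triangle_ineq)
        also have "\<dots> \<le> (B * \<bar>\<epsilon>\<bar> * u 0 z) * (2 * v 0 z) + u 0 z * (C * \<bar>\<epsilon>\<bar> * v 0 z)"
          using du dv v2 u0 v0 B(1) by (intro add_mono mult_mono) auto
        finally show ?thesis by (simp add: algebra_simps)
      qed
      then show ?case using elim by auto
    qed
  qed
qed

text \<open>Where \<open>u 0\<close> vanishes, so does \<open>u \<epsilon>\<close> for small
  \<epsilon>, and all inverses are 0 by convention. Elsewhere \<open>u \<epsilon>\<close> is at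
  least half of \<open>u 0\<close>, and this half in the denominator turns B into 2 B.\<close>

lemma tame_path_inverse:
  assumes u: "tame_path M u"
  shows "tame_path M (\<lambda>\<epsilon> z. inverse (u \<epsilon> z))"
proof -
  obtain B where B: "B \<ge> 0" "\<forall>\<^sub>F \<epsilon> in nhds 0. u \<epsilon> \<in> borel_measurable M \<and>
        (\<forall>z\<in>space M. \<bar>u \<epsilon> z - u 0 z\<bar> \<le> B * \<bar>\<epsilon>\<bar> * u 0 z)"
    using u by (rule tame_pathE)
  show ?thesis
  proof (rule tame_pathI)
    show "0 \<le> inverse (u 0 z)" if "z \<in> space M" for z
      using tame_path_nonneg[OF u that] by simp
    show "(\<lambda>\<epsilon>. inverse (u \<epsilon> z)) differentiable (at 0)" if z: "z \<in> space M" for z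
    proof (cases "u 0 z = 0")
      case True
      have "\<forall>\<^sub>F \<epsilon> in nhds 0. inverse (u \<epsilon> z) = 0"
        using B(2) by eventually_elim (use z True in auto)
      then have "((\<lambda>\<epsilon>. inverse (u \<epsilon> z)) has_real_derivative 0) (at 0) \<longleftrightarrow>
          ((\<lambda>\<epsilon>. 0 :: real) has_real_derivative 0) (at 0)"
        by (intro DERIV_cong_ev) auto
      then show ?thesis by (auto simp: real_differentiable_def)
    next
      case False
      then show ?thesis
        using u z unfolding tame_path_def by (intro differentiable_inverse) auto
    qed
    show "0 \<le> 2 * B" using B by simp
    show "\<forall>\<^sub>F \<epsilon> in nhds 0. (\<lambda>z. inverse (u \<epsilon> z)) \<in> borel_measurable M \<and>
      (\<forall>z\<in>space M. \<bar>inverse (u \<epsilon> z) - inverse (u 0 z)\<bar> \<le> 2 * B * \<bar>\<epsilon>\<bar> * inverse (u 0 z))"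
      using B(2) eventually_lipschitz_small[OF B(1)]
    proof eventually_elim
      case (elim \<epsilon>)
      have "\<bar>inverse (u \<epsilon> z) - inverse (u 0 z)\<bar> \<le> 2 * B * \<bar>\<epsilon>\<bar> * inverse (u 0 z)"
        if z: "z \<in> space M" for z
      proof (cases "u 0 z = 0")
        case True
        then show ?thesis using elim z by auto
      next
        case False
        then have u0: "u 0 z > 0" using tame_path_nonneg[OF u z] by simp
        have du: "\<bar>u \<epsilon> z - u 0 z\<bar> \<le> B * \<bar>\<epsilon>\<bar> * u 0 z" using elim z by auto
        have "B * \<bar>\<epsilon>\<bar> * u 0 z \<le> 1 / 2 * u 0 z"
          using elim u0 by (intro mult_right_mono) auto
        then have ge: "u \<epsilon> z \<ge> u 0 z / 2" using du by linarith
        then have pos: "u \<epsilon> z > 0" using u0 by linarith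
        have "\<bar>inverse (u \<epsilon> z) - inverse (u 0 z)\<bar> = \<bar>u \<epsilon> z - u 0 z\<bar> / (u \<epsilon> z * u 0 z)"
          using pos u0 by (simp add: field_simps abs_divide abs_minus_commute abs_mult)
        also have "\<dots> \<le> (B * \<bar>\<epsilon>\<bar> * u 0 z) / ((u 0 z / 2) * u 0 z)"
          using du ge u0 pos B(1) by (intro frac_le mult_mono) auto
        also have "\<dots> = 2 * B * \<bar>\<epsilon>\<bar> * inverse (u 0 z)"
          using u0 by (simp add: field_simps)
        finally show ?thesis .
      qed
      then show ?case using elim by auto
    qed
  qed
qed

lemma tame_path_divide:
  assumes "tame_path M u" "tame_path M v"
  shows "tame_path M (\<lambda>\<epsilon> z. u \<epsilon> z / v \<epsilon> z)"
  using tame_path_mult[OF assms(1) tame_path_inverse[OF assms(2)]] by (simp add: divide_inverse)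

lemma tame_path_comp:
  assumes u: "tame_path N u" and f: "f \<in> measurable M N"
  shows "tame_path M (\<lambda>\<epsilon> z. u \<epsilon> (f z))"
proof -
  obtain B where B: "B \<ge> 0" "\<forall>\<^sub>F \<epsilon> in nhds 0. u \<epsilon> \<in> borel_measurable N \<and>
        (\<forall>z\<in>space N. \<bar>u \<epsilon> z - u 0 z\<bar> \<le> B * \<bar>\<epsilon>\<bar> * u 0 z)"
    using u by (rule tame_pathE)
  show ?thesis
  proof (rule tame_pathI[OF _ _ B(1)])
    show "0 \<le> u 0 (f z)" if "z \<in> space M" for z
      using tame_path_nonneg[OF u] measurable_space[OF f that] by simp
    show "(\<lambda>\<epsilon>. u \<epsilon> (f z)) differentiable (at 0)" if "z \<in> space M" for z
      using u measurable_space[OF f that] by (auto simp: tame_path_def)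
    show "\<forall>\<^sub>F \<epsilon> in nhds 0. (\<lambda>z. u \<epsilon> (f z)) \<in> borel_measurable M \<and>
      (\<forall>z\<in>space M. \<bar>u \<epsilon> (f z) - u 0 (f z)\<bar> \<le> B * \<bar>\<epsilon>\<bar> * u 0 (f z))"
      using B(2) by eventually_elim (use f measurable_space[OF f] in auto)
  qed
qed

lemma tame_path_eventually_zero:
  assumes u: "tame_path M u" and z: "z \<in> space M" and "u 0 z = 0"
  shows "\<forall>\<^sub>F \<epsilon> in nhds 0. u \<epsilon> z = 0"
proof -
  obtain B where B: "\<forall>\<^sub>F \<epsilon> in nhds 0. u \<epsilon> \<in> borel_measurable M \<and>
        (\<forall>z\<in>space M. \<bar>u \<epsilon> z - u 0 z\<bar> \<le> B * \<bar>\<epsilon>\<bar> * u 0 z)"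
    using u by (rule tame_pathE)
  show ?thesis
    using B by eventually_elim (use assms in auto)
qed

lemma path_deriv_eq_0:
  assumes "\<forall>\<^sub>F \<epsilon> in nhds 0. u \<epsilon> z = 0"
  shows "path_deriv u z = 0"
proof -
  have "((\<lambda>\<epsilon>. u \<epsilon> z) has_real_derivative 0) (at 0) \<longleftrightarrow>
      ((\<lambda>\<epsilon>. 0 :: real) has_real_derivative 0) (at 0)"
    using assms by (intro DERIV_cong_ev) auto
  then show ?thesis unfolding path_deriv_def by (intro DERIV_imp_deriv) auto
qed

text \<open>Collects what dominated convergence needs: one radius, one dominating function for all
  difference quotients, and their limit along sequences. At \<epsilon> = 0 the quotient is 0 by
  convention, so the bound needs no exception.\<close>

lemma tame_path_quotients:
  assumes u: "tame_path M u"
  obtains B \<delta> where "B \<ge> 0" "\<delta> > 0"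
    "\<forall>\<epsilon>. \<bar>\<epsilon>\<bar> < \<delta> \<longrightarrow> u \<epsilon> \<in> borel_measurable M"
    "\<forall>\<epsilon> z. \<bar>\<epsilon>\<bar> < \<delta> \<longrightarrow> z \<in> space M \<longrightarrow> \<bar>(u \<epsilon> z - u 0 z) / \<epsilon>\<bar> \<le> B * u 0 z"
    "\<forall>X z. X \<longlonglongrightarrow> 0 \<longrightarrow> (\<forall>n. X n \<noteq> 0) \<longrightarrow> z \<in> space M \<longrightarrow>
       (\<lambda>n. (u (X n) z - u 0 z) / X n) \<longlonglongrightarrow> path_deriv u z"
proof -
  obtain B where B: "B \<ge> 0" "\<forall>\<^sub>F \<epsilon> in nhds 0. u \<epsilon> \<in> borel_measurable M \<and>
        (\<forall>z\<in>space M. \<bar>u \<epsilon> z - u 0 z\<bar> \<le> B * \<bar>\<epsilon>\<bar> * u 0 z)"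
    using u by (rule tame_pathE)
  obtain \<delta> where \<delta>: "\<delta> > 0" "\<And>\<epsilon>. \<bar>\<epsilon>\<bar> < \<delta> \<Longrightarrow> u \<epsilon> \<in> borel_measurable M \<and>
        (\<forall>z\<in>space M. \<bar>u \<epsilon> z - u 0 z\<bar> \<le> B * \<bar>\<epsilon>\<bar> * u 0 z)"
    using B(2) by (auto simp: eventually_nhds_metric dist_real_def)
  show ?thesis
  proof (rule that[OF B(1) \<delta>(1)], safe)
    show "u \<epsilon> \<in> borel_measurable M" if "\<bar>\<epsilon>\<bar> < \<delta>" for \<epsilon> using \<delta>(2)[OF that] by simp
    show "\<bar>(u \<epsilon> z - u 0 z) / \<epsilon>\<bar> \<le> B * u 0 z" if "\<bar>\<epsilon>\<bar> < \<delta>" "z \<in> space M" for \<epsilon> z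
    proof (cases "\<epsilon> = 0")
      case True
      then show ?thesis using B(1) tame_path_nonneg[OF u that(2)] by simp
    next
      case False
      have "\<bar>u \<epsilon> z - u 0 z\<bar> \<le> B * \<bar>\<epsilon>\<bar> * u 0 z" using \<delta>(2)[OF that(1)] that(2) by simp
      then show ?thesis using False by (simp add: abs_divide pos_divide_le_eq mult_ac)
    qed
    show "(\<lambda>n. (u (X n) z - u 0 z) / X n) \<longlonglongrightarrow> path_deriv u z"
      if "X \<longlonglongrightarrow> 0" "\<forall>n. X n \<noteq> 0" "z \<in> space M" for X z
    proof -
      have "((\<lambda>h. (u (0 + h) z - u 0 z) / h) \<longlongrightarrow> path_deriv u z) (at 0)"
        using tame_path_has_deriv[OF u that(3)] by (simp add: DERIV_def)
      moreover have "filterlim X (at 0) sequentially"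
        using that by (auto simp: filterlim_at)
      ultimately show ?thesis
        by (auto dest: filterlim_compose)
    qed
  qed
qed

lemma small_sequence:
  fixes \<delta> :: real
  assumes "\<delta> > 0"
  obtains X where "X \<longlonglongrightarrow> 0" "\<And>n :: nat. X n \<noteq> 0" "\<And>n. \<bar>X n\<bar> < \<delta>"
proof
  show "(\<lambda>n. \<delta> / 2 * inverse (real (Suc n))) \<longlonglongrightarrow> 0"
    using tendsto_mult_right_zero[OF LIMSEQ_inverse_real_of_nat] .
  show "\<delta> / 2 * inverse (real (Suc n)) \<noteq> 0" for n using assms by simp
  show "\<bar>\<delta> / 2 * inverse (real (Suc n))\<bar> < \<delta>" for n
  proof -
    have "inverse (real (Suc n)) \<le> 1" by (simp add: field_simps)
    then have "\<delta> / 2 * inverse (real (Suc n)) \<le> \<delta> / 2 * 1"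
      using assms by (intro mult_left_mono) auto
    then show ?thesis using assms by auto
  qed
qed

text \<open>A single sequence of parameters tending to 0 suffices to compute the derivative at every
  point, so it is a countable limit of measurable quotients.\<close>

lemma path_deriv_measurable:
  assumes u: "tame_path M u"
  shows "path_deriv u \<in> borel_measurable M"
proof -
  obtain B \<delta> where B: "B \<ge> 0" "\<delta> > 0"
    and quots: "\<forall>\<epsilon>. \<bar>\<epsilon>\<bar> < \<delta> \<longrightarrow> u \<epsilon> \<in> borel_measurable M"
    "\<forall>\<epsilon> z. \<bar>\<epsilon>\<bar> < \<delta> \<longrightarrow> z \<in> space M \<longrightarrow> \<bar>(u \<epsilon> z - u 0 z) / \<epsilon>\<bar> \<le> B * u 0 z"
    "\<forall>X z. X \<longlonglongrightarrow> 0 \<longrightarrow> (\<forall>n. X n \<noteq> 0) \<longrightarrow> z \<in> space M \<longrightarrow>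
       (\<lambda>n. (u (X n) z - u 0 z) / X n) \<longlonglongrightarrow> path_deriv u z"
    using u by (rule tame_path_quotients)
  note B = B quots[rule_format]
  obtain X where X: "X \<longlonglongrightarrow> 0" "\<And>n :: nat. X n \<noteq> 0" "\<And>n. \<bar>X n\<bar> < \<delta>"
    using small_sequence[OF B(2)] by blast
  show ?thesis
  proof (rule borel_measurable_LIMSEQ_metric)
    show "(\<lambda>z. (u (X n) z - u 0 z) / X n) \<in> borel_measurable M" for n
      using B(3)[OF X(3)] tame_path_measurable[OF u] by simp
    show "(\<lambda>n. (u (X n) z - u 0 z) / X n) \<longlonglongrightarrow> path_deriv u z" if "z \<in> space M" for z
      using B(5)[OF X(1,2) that] .
  qed
qed

text \<open>The bound on the quotients passes to the limit. It makes the derivative of a path an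
  admissible direction in \<open>gradient_identity\<close>.\<close>

lemma path_deriv_bound:
  assumes u: "tame_path M u"
  obtains B where "B \<ge> 0" "\<And>z. z \<in> space M \<Longrightarrow> \<bar>path_deriv u z\<bar> \<le> B * u 0 z"
proof -
  obtain B \<delta> where B: "B \<ge> 0" "\<delta> > 0"
    and quots: "\<forall>\<epsilon>. \<bar>\<epsilon>\<bar> < \<delta> \<longrightarrow> u \<epsilon> \<in> borel_measurable M"
    "\<forall>\<epsilon> z. \<bar>\<epsilon>\<bar> < \<delta> \<longrightarrow> z \<in> space M \<longrightarrow> \<bar>(u \<epsilon> z - u 0 z) / \<epsilon>\<bar> \<le> B * u 0 z"
    "\<forall>X z. X \<longlonglongrightarrow> 0 \<longrightarrow> (\<forall>n. X n \<noteq> 0) \<longrightarrow> z \<in> space M \<longrightarrow>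
       (\<lambda>n. (u (X n) z - u 0 z) / X n) \<longlonglongrightarrow> path_deriv u z"
    using u by (rule tame_path_quotients)
  note B = B quots[rule_format]
  obtain X where X: "X \<longlonglongrightarrow> 0" "\<And>n :: nat. X n \<noteq> 0" "\<And>n. \<bar>X n\<bar> < \<delta>"
    using small_sequence[OF B(2)] by blast
  show ?thesis
  proof (rule that[OF B(1)])
    show "\<bar>path_deriv u z\<bar> \<le> B * u 0 z" if z: "z \<in> space M" for z
      using B(4)[OF X(3) z] by (intro LIMSEQ_le_const2[OF tendsto_rabs[OF B(5)[OF X(1,2) z]]]) auto
  qed
qed

text \<open>All difference quotients are dominated by \<open>B * \<bar>c z * u 0 z\<bar>\<close>, so
  c may be unbounded and of either sign. This is how an unbounded outcome is accommodated.\<close>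

lemma tame_path_integral_has_derivative:
  assumes u: "tame_path M u" and c[measurable]: "c \<in> borel_measurable M"
    and int: "integrable M (\<lambda>z. c z * u 0 z)"
  shows "((\<lambda>\<epsilon>. \<integral>z. c z * u \<epsilon> z \<partial>M) has_real_derivative (\<integral>z. c z * path_deriv u z \<partial>M)) (at 0)"
proof -
  obtain B \<delta> where B: "B \<ge> 0" "\<delta> > 0"
    and quots: "\<forall>\<epsilon>. \<bar>\<epsilon>\<bar> < \<delta> \<longrightarrow> u \<epsilon> \<in> borel_measurable M"
    "\<forall>\<epsilon> z. \<bar>\<epsilon>\<bar> < \<delta> \<longrightarrow> z \<in> space M \<longrightarrow> \<bar>(u \<epsilon> z - u 0 z) / \<epsilon>\<bar> \<le> B * u 0 z"
    "\<forall>X z. X \<longlonglongrightarrow> 0 \<longrightarrow> (\<forall>n. X n \<noteq> 0) \<longrightarrow> z \<in> space M \<longrightarrow>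
       (\<lambda>n. (u (X n) z - u 0 z) / X n) \<longlonglongrightarrow> path_deriv u z"
    using u by (rule tame_path_quotients)
  note B = B quots[rule_format]
  note [measurable] = path_deriv_measurable[OF u] tame_path_measurable[OF u]
  have dom: "\<bar>c z * ((u \<epsilon> z - u 0 z) / \<epsilon>)\<bar> \<le> B * \<bar>c z * u 0 z\<bar>"
    if "\<bar>\<epsilon>\<bar> < \<delta>" "z \<in> space M" for \<epsilon> z
    using mult_left_mono[OF B(4)[OF that] abs_ge_zero[of "c z"]] tame_path_nonneg[OF u that(2)]
    by (simp add: abs_mult mult_ac)
  have quot: "((\<integral>z. c z * u \<epsilon> z \<partial>M) - (\<integral>z. c z * u 0 z \<partial>M)) / \<epsilon> =
      (\<integral>z. c z * ((u \<epsilon> z - u 0 z) / \<epsilon>) \<partial>M)" if \<epsilon>: "\<bar>\<epsilon>\<bar> < \<delta>" "\<epsilon> \<noteq> 0" for \<epsilon>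
  proof -
    note [measurable] = B(3)[OF \<epsilon>(1)]
    have i: "integrable M (\<lambda>z. c z * ((u \<epsilon> z - u 0 z) / \<epsilon>))"
    proof (rule Bochner_Integration.integrable_bound)
      show "integrable M (\<lambda>z. B * \<bar>c z * u 0 z\<bar>)" using int by auto
      show "AE z in M. norm (c z * ((u \<epsilon> z - u 0 z) / \<epsilon>)) \<le> norm (B * \<bar>c z * u 0 z\<bar>)"
        using dom[OF \<epsilon>(1)] B(1) by (intro AE_I2) (simp add: abs_mult)
    qed measurable
    \<comment> \<open>Integrability of \<open>c z * u \<epsilon> z\<close> is not known beforehand;
      it results from writing it as the value at 0 plus \<epsilon> times the integrable
      quotient.\<close>
    have "(\<integral>z. c z * u \<epsilon> z \<partial>M) =
        (\<integral>z. c z * u 0 z + \<epsilon> * (c z * ((u \<epsilon> z - u 0 z) / \<epsilon>)) \<partial>M)"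
      using \<epsilon>(2) by (intro Bochner_Integration.integral_cong) (auto simp: field_simps)
    also have "\<dots> = (\<integral>z. c z * u 0 z \<partial>M) + \<epsilon> * (\<integral>z. c z * ((u \<epsilon> z - u 0 z) / \<epsilon>) \<partial>M)"
      using Bochner_Integration.integral_add[OF int integrable_mult_right[OF i, of \<epsilon>]]
      by (simp only: integral_mult_right_zero)
    finally show ?thesis using \<epsilon>(2) by simp
  qed
  \<comment> \<open>Restricting to the ball makes the quotient bounds available for every member of
    a sequence, not just eventually; the ball is open, so the limit is the same.\<close>
  have "((\<lambda>\<epsilon>. ((\<integral>z. c z * u \<epsilon> z \<partial>M) - (\<integral>z. c z * u 0 z \<partial>M)) / \<epsilon>)
      \<longlongrightarrow> (\<integral>z. c z * path_deriv u z \<partial>M)) (at 0 within ball 0 \<delta>)"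
    unfolding tendsto_at_iff_sequentially
  proof (intro allI impI)
    fix X :: "nat \<Rightarrow> real"
    assume X: "\<forall>i. X i \<in> ball 0 \<delta> - {0}" "X \<longlonglongrightarrow> 0"
    have X': "\<bar>X n\<bar> < \<delta>" "X n \<noteq> 0" for n using X(1) by (auto simp: dist_real_def)
    note [measurable] = B(3)[OF X'(1)]
    have "(\<lambda>n. \<integral>z. c z * ((u (X n) z - u 0 z) / X n) \<partial>M) \<longlonglongrightarrow> (\<integral>z. c z * path_deriv u z \<partial>M)"
    proof (rule integral_dominated_convergence[where w = "\<lambda>z. B * \<bar>c z * u 0 z\<bar>"])
      show "AE z in M. (\<lambda>n. c z * ((u (X n) z - u 0 z) / X n)) \<longlonglongrightarrow> c z * path_deriv u z"
        using B(5)[OF X(2) X'(2)] by (intro AE_I2 tendsto_mult) auto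
      show "integrable M (\<lambda>z. B * \<bar>c z * u 0 z\<bar>)" using int by auto
      show "AE z in M. norm (c z * ((u (X n) z - u 0 z) / X n)) \<le> B * \<bar>c z * u 0 z\<bar>" for n
        using dom[OF X'(1)] by (intro AE_I2) auto
    qed auto
    then show "((\<lambda>\<epsilon>. ((\<integral>z. c z * u \<epsilon> z \<partial>M) - (\<integral>z. c z * u 0 z \<partial>M)) / \<epsilon>) \<circ> X)
        \<longlonglongrightarrow> (\<integral>z. c z * path_deriv u z \<partial>M)"
      by (simp only: o_def quot[OF X'])
  qed
  then show ?thesis
    using B(2) by (simp add: DERIV_def at_within_open[of 0 "ball 0 \<delta>"])
qed

text \<open>The relative bound integrates to itself with the same constant. No section has to be
  integrable: once the relative change is at most 1/2, sections at \<epsilon> and at 0 dominate each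
  other up to a factor 2, so either both integrals are genuine or both are 0 by default.\<close>

lemma tame_path_integral:
  assumes u: "tame_path (M \<Otimes>\<^sub>M N) u" and N: "sigma_finite_measure N"
  shows "tame_path M (\<lambda>\<epsilon> x. \<integral>y. u \<epsilon> (x, y) \<partial>N)"
proof -
  obtain B where B: "B \<ge> 0" "\<forall>\<^sub>F \<epsilon> in nhds 0. u \<epsilon> \<in> borel_measurable (M \<Otimes>\<^sub>M N) \<and>
        (\<forall>z\<in>space (M \<Otimes>\<^sub>M N). \<bar>u \<epsilon> z - u 0 z\<bar> \<le> B * \<bar>\<epsilon>\<bar> * u 0 z)"
    using u by (rule tame_pathE)
  note [measurable] = tame_path_measurable[OF u]
  have sec: "tame_path N (\<lambda>\<epsilon> y. u \<epsilon> (x, y))" if "x \<in> space M" for x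
    using tame_path_comp[OF u, of "Pair x"] that by simp
  have nn: "0 \<le> u 0 (x, y)" if "x \<in> space M" "y \<in> space N" for x y
    using tame_path_nonneg[OF u] that by (simp add: space_pair_measure)
  have est: "integrable N (\<lambda>y. u \<epsilon> (x, y)) \<longleftrightarrow> integrable N (\<lambda>y. u 0 (x, y))"
    "\<bar>(\<integral>y. u \<epsilon> (x, y) \<partial>N) - (\<integral>y. u 0 (x, y) \<partial>N)\<bar> \<le> B * \<bar>\<epsilon>\<bar> * (\<integral>y. u 0 (x, y) \<partial>N)"
    if e: "u \<epsilon> \<in> borel_measurable (M \<Otimes>\<^sub>M N)"
      "\<forall>z\<in>space (M \<Otimes>\<^sub>M N). \<bar>u \<epsilon> z - u 0 z\<bar> \<le> B * \<bar>\<epsilon>\<bar> * u 0 z"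
      "B * \<bar>\<epsilon>\<bar> \<le> 1 / 2" and x: "x \<in> space M" for \<epsilon> x
  proof -
    note [measurable] = e(1) x
    have d: "\<bar>u \<epsilon> (x, y) - u 0 (x, y)\<bar> \<le> B * \<bar>\<epsilon>\<bar> * u 0 (x, y)" if "y \<in> space N" for y
      using e(2) x that by (simp add: space_pair_measure)
    have h: "B * \<bar>\<epsilon>\<bar> * u 0 (x, y) \<le> 1 / 2 * u 0 (x, y)" if "y \<in> space N" for y
      using e(3) nn[OF x that] by (rule mult_right_mono)
    have up: "\<bar>u \<epsilon> (x, y)\<bar> \<le> 2 * u 0 (x, y)" "u 0 (x, y) \<le> 2 * \<bar>u \<epsilon> (x, y)\<bar>"
      if "y \<in> space N" for y
      using d[OF that] h[OF that] nn[OF x that] by linarith+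
    show iff: "integrable N (\<lambda>y. u \<epsilon> (x, y)) \<longleftrightarrow> integrable N (\<lambda>y. u 0 (x, y))"
    proof
      assume "integrable N (\<lambda>y. u \<epsilon> (x, y))"
      then have "integrable N (\<lambda>y. 2 * \<bar>u \<epsilon> (x, y)\<bar>)" by simp
      then show "integrable N (\<lambda>y. u 0 (x, y))"
        by (rule Bochner_Integration.integrable_bound)
          (use up nn x in \<open>auto intro!: AE_I2\<close>)
    next
      assume "integrable N (\<lambda>y. u 0 (x, y))"
      then have "integrable N (\<lambda>y. 2 * u 0 (x, y))" by simp
      then show "integrable N (\<lambda>y. u \<epsilon> (x, y))"
        by (rule Bochner_Integration.integrable_bound)
          (use up nn x in \<open>auto intro!: AE_I2\<close>)
    qed
    show "\<bar>(\<integral>y. u \<epsilon> (x, y) \<partial>N) - (\<integral>y. u 0 (x, y) \<partial>N)\<bar> \<le> B * \<bar>\<epsilon>\<bar> * (\<integral>y. u 0 (x, y) \<partial>N)"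
    proof (cases "integrable N (\<lambda>y. u 0 (x, y))")
      case True
      have "\<bar>(\<integral>y. u \<epsilon> (x, y) \<partial>N) - (\<integral>y. u 0 (x, y) \<partial>N)\<bar> =
          \<bar>\<integral>y. u \<epsilon> (x, y) - u 0 (x, y) \<partial>N\<bar>"
        using True iff by simp
      also have "\<dots> \<le> (\<integral>y. \<bar>u \<epsilon> (x, y) - u 0 (x, y)\<bar> \<partial>N)" by (rule integral_abs_bound)
      also have "\<dots> \<le> (\<integral>y. B * \<bar>\<epsilon>\<bar> * u 0 (x, y) \<partial>N)"
        using True iff d by (intro integral_mono) auto
      finally show ?thesis by simp
    next
      case False
      then show ?thesis using iff by (simp add: not_integrable_integral_eq)
    qed
  qed
  show ?thesis
  proof (rule tame_pathI[OF _ _ B(1)])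
    show "0 \<le> (\<integral>y. u 0 (x, y) \<partial>N)" if "x \<in> space M" for x
      using nn[OF that] by (intro integral_nonneg_AE AE_I2)
    show "(\<lambda>\<epsilon>. \<integral>y. u \<epsilon> (x, y) \<partial>N) differentiable (at 0)" if x: "x \<in> space M" for x
    proof (cases "integrable N (\<lambda>y. u 0 (x, y))")
      case True
      then show ?thesis
        using tame_path_integral_has_derivative[OF sec[OF x], of "\<lambda>_. 1"]
        by (auto simp: real_differentiable_def)
    next
      case False
      have "\<forall>\<^sub>F \<epsilon> in nhds 0. (\<integral>y. u \<epsilon> (x, y) \<partial>N) = 0"
        using B(2) eventually_lipschitz_small[OF B(1)]
        by eventually_elim (use est(1)[OF _ _ _ x] False in \<open>auto intro!: not_integrable_integral_eq\<close>)
      then have "((\<lambda>\<epsilon>. \<integral>y. u \<epsilon> (x, y) \<partial>N) has_real_derivative 0) (at 0) \<longleftrightarrow>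
          ((\<lambda>\<epsilon>. 0 :: real) has_real_derivative 0) (at 0)"
        by (intro DERIV_cong_ev) auto
      then show ?thesis by (auto simp: real_differentiable_def)
    qed
    show "\<forall>\<^sub>F \<epsilon> in nhds 0. (\<lambda>x. \<integral>y. u \<epsilon> (x, y) \<partial>N) \<in> borel_measurable M \<and>
      (\<forall>x\<in>space M. \<bar>(\<integral>y. u \<epsilon> (x, y) \<partial>N) - (\<integral>y. u 0 (x, y) \<partial>N)\<bar> \<le>
         B * \<bar>\<epsilon>\<bar> * (\<integral>y. u 0 (x, y) \<partial>N))"
      using B(2) eventually_lipschitz_small[OF B(1)]
      by eventually_elim
        (use est(2) in \<open>auto intro!: sigma_finite_measure.borel_measurable_lebesgue_integral[OF N]\<close>)
  qed
qed

lemma path_deriv_integral: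
  assumes u: "tame_path (M \<Otimes>\<^sub>M N) u"
    and x: "x \<in> space M" and int: "integrable N (\<lambda>y. u 0 (x, y))"
  shows "path_deriv (\<lambda>\<epsilon> x. \<integral>y. u \<epsilon> (x, y) \<partial>N) x = (\<integral>y. path_deriv u (x, y) \<partial>N)"
proof -
  have "tame_path N (\<lambda>\<epsilon> y. u \<epsilon> (x, y))"
    using tame_path_comp[OF u, of "Pair x"] x by simp
  from tame_path_integral_has_derivative[OF this, of "\<lambda>_. 1"] int
  show ?thesis
    unfolding path_deriv_def by (intro DERIV_imp_deriv) simp
qed

section \<open>Marginals of a density\<close>

lemma (in pair_sigma_finite) AE_fst:
  assumes "AE x in M1. P x"
  shows "AE z in M1 \<Otimes>\<^sub>M M2. P (fst z)"
proof -
  \<comment> \<open>P need not be measurable, so it is replaced by avoidance of a measurable null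
    set, for which the product criterion is available.\<close>
  obtain N where N: "{x \<in> space M1. \<not> P x} \<subseteq> N" "emeasure M1 N = 0" "N \<in> sets M1"
    using assms by (rule AE_E)
  note [measurable] = N(3)
  have "AE x in M1. AE y in M2. fst (x, y) \<notin> N"
    using AE_not_in[of N M1] N by (auto simp: null_sets_def)
  then have "AE z in M1 \<Otimes>\<^sub>M M2. fst z \<notin> N"
    by (intro AE_pair_measure) auto
  then show ?thesis
    using AE_space by eventually_elim (use N in \<open>auto simp: space_pair_measure\<close>)
qed

lemma (in pair_sigma_finite) AE_snd:
  assumes "AE y in M2. P y"
  shows "AE z in M1 \<Otimes>\<^sub>M M2. P (snd z)"
proof -
  obtain N where N: "{y \<in> space M2. \<not> P y} \<subseteq> N" "emeasure M2 N = 0" "N \<in> sets M2"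
    using assms by (rule AE_E)
  note [measurable] = N(3)
  have "AE y in M2. y \<notin> N" using AE_not_in[of N M2] N by (auto simp: null_sets_def)
  then have "AE x in M1. AE y in M2. snd (x, y) \<notin> N" by simp
  then have "AE z in M1 \<Otimes>\<^sub>M M2. snd z \<notin> N"
    by (intro AE_pair_measure) auto
  then show ?thesis
    using AE_space by eventually_elim (use N in \<open>auto simp: space_pair_measure\<close>)
qed

text \<open>The Bochner integral is 0 on a section that is not integrable, where the true marginal
  is infinite. As p is integrable, such sections form a null set and the density is
  unaffected.\<close>

lemma (in pair_sigma_finite) distr_density_fst:
  fixes p :: "'a \<times> 'b \<Rightarrow> real"
  assumes p: "integrable (M1 \<Otimes>\<^sub>M M2) p" and nn: "\<And>z. z \<in> space (M1 \<Otimes>\<^sub>M M2) \<Longrightarrow> 0 \<le> p z"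
  shows "distr (density (M1 \<Otimes>\<^sub>M M2) (\<lambda>z. ennreal (p z))) M1 fst =
    density M1 (\<lambda>x. ennreal (\<integral>y. p (x, y) \<partial>M2))"
proof (rule measure_eqI)
  note [measurable] = borel_measurable_integrable[OF p]
  fix A assume "A \<in> sets (distr (density (M1 \<Otimes>\<^sub>M M2) (\<lambda>z. ennreal (p z))) M1 fst)"
  then have [measurable]: "A \<in> sets M1" by simp
  have "emeasure (distr (density (M1 \<Otimes>\<^sub>M M2) (\<lambda>z. ennreal (p z))) M1 fst) A =
      (\<integral>\<^sup>+ z. ennreal (p z) * indicator (fst -` A \<inter> space (M1 \<Otimes>\<^sub>M M2)) z \<partial>(M1 \<Otimes>\<^sub>M M2))"
    by (subst emeasure_distr) (auto simp: emeasure_density)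
  also have "\<dots> = (\<integral>\<^sup>+ z. ennreal (p z) * indicator A (fst z) \<partial>(M1 \<Otimes>\<^sub>M M2))"
    by (intro nn_integral_cong) (auto simp: indicator_def)
  also have "\<dots> = (\<integral>\<^sup>+ x. \<integral>\<^sup>+ y. ennreal (p (x, y)) * indicator A x \<partial>M2 \<partial>M1)"
    by (subst M2.nn_integral_fst[symmetric]) auto
  also have "\<dots> = (\<integral>\<^sup>+ x. ennreal (\<integral>y. p (x, y) \<partial>M2) * indicator A x \<partial>M1)"
  proof (rule nn_integral_cong_AE)
    show "AE x in M1. (\<integral>\<^sup>+ y. ennreal (p (x, y)) * indicator A x \<partial>M2) =
        ennreal (\<integral>y. p (x, y) \<partial>M2) * indicator A x"
      using AE_integrable_fst'[OF p] AE_space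
    proof eventually_elim
      case (elim x)
      note [measurable] = elim(2)
      show ?case
        using elim nn by (subst nn_integral_multc)
          (auto simp: nn_integral_eq_integral space_pair_measure)
    qed
  qed
  also have "\<dots> = emeasure (density M1 (\<lambda>x. ennreal (\<integral>y. p (x, y) \<partial>M2))) A"
    by (subst emeasure_density) auto
  finally show "emeasure (distr (density (M1 \<Otimes>\<^sub>M M2) (\<lambda>z. ennreal (p z))) M1 fst) A =
    emeasure (density M1 (\<lambda>x. ennreal (\<integral>y. p (x, y) \<partial>M2))) A" .
qed simp

lemma (in pair_sigma_finite) distr_density_snd:
  fixes p :: "'a \<times> 'b \<Rightarrow> real"
  assumes p: "integrable (M1 \<Otimes>\<^sub>M M2) p" and nn: "\<And>z. z \<in> space (M1 \<Otimes>\<^sub>M M2) \<Longrightarrow> 0 \<le> p z"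
  shows "distr (density (M1 \<Otimes>\<^sub>M M2) (\<lambda>z. ennreal (p z))) M2 snd =
    density M2 (\<lambda>y. ennreal (\<integral>x. p (x, y) \<partial>M1))"
proof (rule measure_eqI)
  note [measurable] = borel_measurable_integrable[OF p]
  have p': "integrable (M1 \<Otimes>\<^sub>M M2) (case_prod (\<lambda>x y. p (x, y)))" using p by simp
  fix A assume "A \<in> sets (distr (density (M1 \<Otimes>\<^sub>M M2) (\<lambda>z. ennreal (p z))) M2 snd)"
  then have [measurable]: "A \<in> sets M2" by simp
  have "emeasure (distr (density (M1 \<Otimes>\<^sub>M M2) (\<lambda>z. ennreal (p z))) M2 snd) A =
      (\<integral>\<^sup>+ z. ennreal (p z) * indicator (snd -` A \<inter> space (M1 \<Otimes>\<^sub>M M2)) z \<partial>(M1 \<Otimes>\<^sub>M M2))"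
    by (subst emeasure_distr) (auto simp: emeasure_density)
  also have "\<dots> = (\<integral>\<^sup>+ z. ennreal (p z) * indicator A (snd z) \<partial>(M1 \<Otimes>\<^sub>M M2))"
    by (intro nn_integral_cong) (auto simp: indicator_def)
  also have "\<dots> = (\<integral>\<^sup>+ y. \<integral>\<^sup>+ x. ennreal (p (x, y)) * indicator A y \<partial>M1 \<partial>M2)"
    by (subst nn_integral_snd[symmetric]) auto
  also have "\<dots> = (\<integral>\<^sup>+ y. ennreal (\<integral>x. p (x, y) \<partial>M1) * indicator A y \<partial>M2)"
  proof (rule nn_integral_cong_AE)
    show "AE y in M2. (\<integral>\<^sup>+ x. ennreal (p (x, y)) * indicator A y \<partial>M1) =
        ennreal (\<integral>x. p (x, y) \<partial>M1) * indicator A y"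
      using AE_integrable_snd[OF p'] AE_space
    proof eventually_elim
      case (elim y)
      note [measurable] = elim(2)
      show ?case
        using elim nn by (subst nn_integral_multc)
          (auto simp: nn_integral_eq_integral space_pair_measure)
    qed
  qed
  also have "\<dots> = emeasure (density M2 (\<lambda>y. ennreal (\<integral>x. p (x, y) \<partial>M1))) A"
    by (subst emeasure_density) auto
  finally show "emeasure (distr (density (M1 \<Otimes>\<^sub>M M2) (\<lambda>z. ennreal (p z))) M2 snd) A =
    emeasure (density M2 (\<lambda>y. ennreal (\<integral>x. p (x, y) \<partial>M1))) A" .
qed simp

lemma prob_density_integrable:
  assumes "prob_density M q"
  shows "integrable M q" "(\<integral>z. q z \<partial>M) = 1"
proof -
  have q: "q \<in> borel_measurable M" "AE z in M. 0 \<le> q z" "(\<integral>\<^sup>+ z. ennreal (q z) \<partial>M) = 1"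
    using assms by (auto simp: prob_density_def)
  show "integrable M q" using q by (intro integrableI_nonneg) auto
  show "(\<integral>z. q z \<partial>M) = 1" using q by (subst integral_eq_nn_integral) auto
qed

section \<open>Iterated integrals and marginals over covariates, treatment and outcome\<close>

locale observation_space =
  fixes NL :: "'l measure" and AA :: "real set" and NY :: "real measure"
  assumes sigma_finite_NL: "sigma_finite_measure NL"
    and sigma_finite_NY: "sigma_finite_measure NY"
    and sets_NY [measurable_cong]: "sets NY = sets borel"
    and AA: "AA \<in> sets borel"
begin

abbreviation "\<alpha> \<equiv> leb_on AA"
abbreviation "LA \<equiv> NL \<Otimes>\<^sub>M \<alpha>"
abbreviation "M \<equiv> dominating NL AA NY"

sublocale L: sigma_finite_measure NL by (rule sigma_finite_NL)
sublocale Y: sigma_finite_measure NY by (rule sigma_finite_NY)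
sublocale A: sigma_finite_measure \<alpha>
  by (rule sigma_finite_measure_restrict_space) (use AA lborel.sigma_finite_measure_axioms in auto)
sublocale LA: pair_sigma_finite NL \<alpha> ..
sublocale AY: pair_sigma_finite \<alpha> NY ..
sublocale LAY: pair_sigma_finite LA NY
  by (intro pair_sigma_finite.intro LA.sigma_finite_measure_axioms Y.sigma_finite_measure_axioms)

lemma space_NY [simp]: "space NY = UNIV"
  using sets_eq_imp_space_eq[OF sets_NY] by simp

lemma space_M: "space M = space NL \<times> AA \<times> UNIV"
  by (auto simp: dominating_def space_pair_measure space_restrict_space)

lemma measurable_M_proj [measurable]:
  "fst \<in> measurable M NL" "(\<lambda>z. fst (snd z)) \<in> measurable M \<alpha>"
  "(\<lambda>z. (fst z, fst (snd z))) \<in> measurable M LA"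
  "(\<lambda>z. snd (snd z)) \<in> borel_measurable M"
  unfolding dominating_def by measurable

lemma measurable_M_assoc [measurable]:
  "(\<lambda>x. (fst (fst x), snd (fst x), snd x)) \<in> measurable (LA \<Otimes>\<^sub>M NY) M"
  unfolding dominating_def by measurable

text \<open>The dominating measure pairs the treatment with the outcome, whereas every conditional
  quantity integrates the outcome first for a fixed pair of covariates and treatment. Reassociating
  the product makes the standard Fubini theorems apply in that order.\<close>

lemma M_eq_distr: "M = distr (LA \<Otimes>\<^sub>M NY) M (\<lambda>x. (fst (fst x), snd (fst x), snd x))"
proof (rule measure_eqI)
  fix B assume [measurable]: "B \<in> sets M"
  then have B: "B \<in> sets (NL \<Otimes>\<^sub>M (\<alpha> \<Otimes>\<^sub>M NY))" by (simp add: dominating_def)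
  have "emeasure M B = (\<integral>\<^sup>+ l. \<integral>\<^sup>+ x. indicator B (l, x) \<partial>(\<alpha> \<Otimes>\<^sub>M NY) \<partial>NL)"
    using B by (simp add: dominating_def sigma_finite_measure.nn_integral_fst[OF AY.sigma_finite_measure_axioms])
  also have "\<dots> = (\<integral>\<^sup>+ l. \<integral>\<^sup>+ a. \<integral>\<^sup>+ y. indicator B (l, a, y) \<partial>NY \<partial>\<alpha> \<partial>NL)"
    using B by (intro nn_integral_cong, subst Y.nn_integral_fst) auto
  also have "\<dots> = (\<integral>\<^sup>+ x. \<integral>\<^sup>+ y. indicator B (fst x, snd x, y) \<partial>NY \<partial>LA)"
    using B by (subst A.nn_integral_fst[symmetric]) auto
  also have "\<dots> = (\<integral>\<^sup>+ x. indicator B (fst (fst x), snd (fst x), snd x) \<partial>(LA \<Otimes>\<^sub>M NY))"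
    using B by (subst Y.nn_integral_fst[symmetric]) auto
  also have "\<dots> = (\<integral>\<^sup>+ z. indicator B z \<partial>distr (LA \<Otimes>\<^sub>M NY) M (\<lambda>x. (fst (fst x), snd (fst x), snd x)))"
    by (subst nn_integral_distr) auto
  also have "\<dots> = emeasure (distr (LA \<Otimes>\<^sub>M NY) M (\<lambda>x. (fst (fst x), snd (fst x), snd x))) B"
    by simp
  finally show "emeasure M B = emeasure (distr (LA \<Otimes>\<^sub>M NY) M (\<lambda>x. (fst (fst x), snd (fst x), snd x))) B" .
qed simp

lemma integrable_M_iff:
  fixes f :: "'l \<times> real \<times> real \<Rightarrow> real"
  assumes "f \<in> borel_measurable M"
  shows "integrable M f \<longleftrightarrow> integrable (LA \<Otimes>\<^sub>M NY) (\<lambda>x. f (fst (fst x), snd (fst x), snd x))"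
  by (subst M_eq_distr, subst integrable_distr_eq) (use assms in auto)

lemma integral_M:
  fixes f :: "'l \<times> real \<times> real \<Rightarrow> real"
  assumes "integrable M f"
  shows "(\<integral>z. f z \<partial>M) = (\<integral>x. \<integral>y. f (fst x, snd x, y) \<partial>NY \<partial>LA)"
    and "integrable LA (\<lambda>x. \<integral>y. f (fst x, snd x, y) \<partial>NY)"
    and "AE x in LA. integrable NY (\<lambda>y. f (fst x, snd x, y))"
proof -
  have f: "f \<in> borel_measurable M" using assms by simp
  then have i: "integrable (LA \<Otimes>\<^sub>M NY) (\<lambda>x. f (fst (fst x), snd (fst x), snd x))"
    using assms integrable_M_iff by blast
  have "(\<integral>z. f z \<partial>M) = (\<integral>x. f (fst (fst x), snd (fst x), snd x) \<partial>(LA \<Otimes>\<^sub>M NY))"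
    by (subst M_eq_distr, subst integral_distr) (use f in auto)
  then show "(\<integral>z. f z \<partial>M) = (\<integral>x. \<integral>y. f (fst x, snd x, y) \<partial>NY \<partial>LA)"
    using LAY.integral_fst'[OF i] by simp
  show "integrable LA (\<lambda>x. \<integral>y. f (fst x, snd x, y) \<partial>NY)"
    using LAY.integrable_fst'[OF i] by simp
  show "AE x in LA. integrable NY (\<lambda>y. f (fst x, snd x, y))"
    using LAY.AE_integrable_fst'[OF i] by simp
qed

lemma nn_integral_M:
  assumes [measurable]: "f \<in> borel_measurable M"
  shows "(\<integral>\<^sup>+ z. f z \<partial>M) = (\<integral>\<^sup>+ x. \<integral>\<^sup>+ y. f (fst x, snd x, y) \<partial>NY \<partial>LA)"
proof -
  have "(\<integral>\<^sup>+ z. f z \<partial>M) = (\<integral>\<^sup>+ x. f (fst (fst x), snd (fst x), snd x) \<partial>(LA \<Otimes>\<^sub>M NY))"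
    by (subst M_eq_distr, subst nn_integral_distr) auto
  also have "\<dots> = (\<integral>\<^sup>+ x. \<integral>\<^sup>+ y. f (fst x, snd x, y) \<partial>NY \<partial>LA)"
    by (subst Y.nn_integral_fst[symmetric]) auto
  finally show ?thesis .
qed

lemma AE_M_LA:
  assumes "AE x in LA. P x"
  shows "AE z in M. P (fst z, fst (snd z))"
proof -
  obtain N where N: "{x \<in> space LA. \<not> P x} \<subseteq> N" "emeasure LA N = 0" "N \<in> sets LA"
    using assms by (rule AE_E)
  note [measurable] = N(3)
  have "AE x in LA. x \<notin> N" using AE_not_in[of N LA] N by (auto simp: null_sets_def)
  then have "AE x in LA \<Otimes>\<^sub>M NY. fst x \<notin> N" by (rule LAY.AE_fst)
  then have "AE z in M. (fst z, fst (snd z)) \<notin> N"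
    by (subst M_eq_distr, subst AE_distr_iff) auto
  then show ?thesis
    using AE_space
    by eventually_elim (use N in \<open>auto simp: space_pair_measure space_M space_restrict_space\<close>)
qed

text \<open>The treatment marginal is written as the mixture of conditional densities that the
  definition of the parameter uses, so that it agrees with it everywhere and not only almost
  everywhere.\<close>

definition dens_LA :: "('l \<times> real \<times> real \<Rightarrow> real) \<Rightarrow> 'l \<times> real \<Rightarrow> real" where
  "dens_LA q x = (\<integral>y. q (fst x, snd x, y) \<partial>NY)"

definition dens_L :: "('l \<times> real \<times> real \<Rightarrow> real) \<Rightarrow> 'l \<Rightarrow> real" where
  "dens_L q l = (\<integral>a. dens_LA q (l, a) \<partial>\<alpha>)"

definition dens_A :: "('l \<times> real \<times> real \<Rightarrow> real) \<Rightarrow> real \<Rightarrow> real" where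
  "dens_A q a = (\<integral>l. dens_L q l * (dens_LA q (l, a) / dens_L q l) \<partial>NL)"

definition mean :: "('l \<times> real \<times> real \<Rightarrow> real) \<Rightarrow> 'l \<times> real \<Rightarrow> real" where
  "mean q x = (\<integral>y. y * (q (fst x, snd x, y) / dens_LA q x) \<partial>NY)"

lemma dens_LA_measurable [measurable]:
  assumes "q \<in> borel_measurable M"
  shows "dens_LA q \<in> borel_measurable LA"
proof -
  have [measurable]: "q \<in> borel_measurable (NL \<Otimes>\<^sub>M (\<alpha> \<Otimes>\<^sub>M NY))"
    using assms by (simp add: dominating_def)
  show ?thesis unfolding dens_LA_def by measurable
qed

lemma dens_L_measurable [measurable]:
  assumes [measurable]: "q \<in> borel_measurable M"
  shows "dens_L q \<in> borel_measurable NL"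
  unfolding dens_L_def by measurable

lemma dens_A_measurable [measurable]:
  assumes [measurable]: "q \<in> borel_measurable M"
  shows "dens_A q \<in> borel_measurable \<alpha>"
  unfolding dens_A_def by measurable

lemma mean_measurable [measurable]:
  assumes q[measurable]: "q \<in> borel_measurable M"
  shows "mean q \<in> borel_measurable LA"
proof -
  have [measurable]: "q \<in> borel_measurable (NL \<Otimes>\<^sub>M (\<alpha> \<Otimes>\<^sub>M NY))"
    using assms by (simp add: dominating_def)
  show ?thesis unfolding mean_def by measurable
qed

lemma dens_LA_integrable:
  assumes "integrable M q"
  shows "integrable LA (dens_LA q)" "(\<integral>x. dens_LA q x \<partial>LA) = (\<integral>z. q z \<partial>M)"
    "AE l in NL. integrable \<alpha> (\<lambda>a. dens_LA q (l, a))" "integrable NL (dens_L q)"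
    "(\<integral>l. dens_L q l \<partial>NL) = (\<integral>z. q z \<partial>M)"
proof -
  show i: "integrable LA (dens_LA q)" using integral_M[OF assms] unfolding dens_LA_def by simp
  show e: "(\<integral>x. dens_LA q x \<partial>LA) = (\<integral>z. q z \<partial>M)" using integral_M[OF assms] unfolding dens_LA_def by simp
  show "AE l in NL. integrable \<alpha> (\<lambda>a. dens_LA q (l, a))" "integrable NL (dens_L q)"
    "(\<integral>l. dens_L q l \<partial>NL) = (\<integral>z. q z \<partial>M)"
    using LA.AE_integrable_fst'[OF i] LA.integrable_fst'[OF i] LA.integral_fst'[OF i] e
    unfolding dens_L_def by auto
qed

lemma dens_LA_nonneg:
  assumes "\<And>z. z \<in> space M \<Longrightarrow> 0 \<le> q z" "l \<in> space NL" "a \<in> AA"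
  shows "0 \<le> dens_LA q (l, a)"
  unfolding dens_LA_def using assms by (intro integral_nonneg_AE AE_I2) (auto simp: space_M)

lemma dens_L_nonneg:
  assumes "\<And>z. z \<in> space M \<Longrightarrow> 0 \<le> q z" "l \<in> space NL"
  shows "0 \<le> dens_L q l"
  unfolding dens_L_def using dens_LA_nonneg[OF assms]
  by (intro integral_nonneg_AE AE_I2) (auto simp: space_restrict_space)

lemma dens_A_nonneg:
  assumes "\<And>z. z \<in> space M \<Longrightarrow> 0 \<le> q z" "a \<in> AA"
  shows "0 \<le> dens_A q a"
  unfolding dens_A_def using dens_LA_nonneg[of q] dens_L_nonneg[of q] assms
  by (intro integral_nonneg_AE AE_I2) auto

lemma distr_law_LA:
  assumes q: "prob_density M q"
  shows "distr (law M q) LA (\<lambda>z. (fst z, fst (snd z))) = density LA (\<lambda>x. ennreal (dens_LA q x))"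
proof (rule measure_eqI)
  have [measurable]: "q \<in> borel_measurable M" and nn: "\<And>z. z \<in> space M \<Longrightarrow> 0 \<le> q z"
    using q by (auto simp: prob_density_def)
  fix B assume "B \<in> sets (distr (law M q) LA (\<lambda>z. (fst z, fst (snd z))))"
  then have [measurable]: "B \<in> sets LA" by simp
  have "emeasure (distr (law M q) LA (\<lambda>z. (fst z, fst (snd z)))) B =
     (\<integral>\<^sup>+ z. ennreal (q z) * indicator ((\<lambda>z. (fst z, fst (snd z))) -` B \<inter> space M) z \<partial>M)"
    unfolding law_def by (subst emeasure_distr) (auto simp: emeasure_density)
  also have "\<dots> = (\<integral>\<^sup>+ z. ennreal (q z) * indicator B (fst z, fst (snd z)) \<partial>M)"
    by (intro nn_integral_cong) (auto simp: indicator_def)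
  also have "\<dots> = (\<integral>\<^sup>+ x. \<integral>\<^sup>+ y. ennreal (q (fst x, snd x, y)) * indicator B x \<partial>NY \<partial>LA)"
    by (subst nn_integral_M) auto
  also have "\<dots> = (\<integral>\<^sup>+ x. ennreal (dens_LA q x) * indicator B x \<partial>LA)"
  proof (rule nn_integral_cong_AE)
    show "AE x in LA. (\<integral>\<^sup>+ y. ennreal (q (fst x, snd x, y)) * indicator B x \<partial>NY) =
        ennreal (dens_LA q x) * indicator B x"
      using integral_M(3)[OF prob_density_integrable(1)[OF q]] AE_space
    proof eventually_elim
      case (elim x)
      have m: "(\<lambda>y. ennreal (q (fst x, snd x, y))) \<in> borel_measurable NY" using elim by auto
      show ?case
        unfolding dens_LA_def
        using elim nn by (subst nn_integral_multc[OF m], subst nn_integral_eq_integral)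
          (auto simp: space_pair_measure space_M space_restrict_space)
    qed
  qed
  also have "\<dots> = emeasure (density LA (\<lambda>x. ennreal (dens_LA q x))) B"
    by (subst emeasure_density) auto
  finally show "emeasure (distr (law M q) LA (\<lambda>z. (fst z, fst (snd z)))) B =
    emeasure (density LA (\<lambda>x. ennreal (dens_LA q x))) B" .
qed simp

lemma sets_law [measurable_cong]: "sets (law M q) = sets M"
  by (simp add: law_def)

lemma covariate_law_eq:
  assumes q: "prob_density M q"
  shows "covariate_law NL AA NY q = density NL (\<lambda>l. ennreal (dens_L q l))"
proof -
  have nn: "\<And>z. z \<in> space M \<Longrightarrow> 0 \<le> q z"
    using q by (auto simp: prob_density_def)
  have "covariate_law NL AA NY q = distr (distr (law M q) LA (\<lambda>z. (fst z, fst (snd z)))) NL fst"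
    unfolding covariate_law_def by (subst distr_distr) (auto simp: o_def)
  also have "\<dots> = density NL (\<lambda>l. ennreal (dens_L q l))"
    unfolding distr_law_LA[OF q] dens_L_def
    using dens_LA_integrable(1)[OF prob_density_integrable(1)[OF q]] dens_LA_nonneg[OF nn]
    by (intro LA.distr_density_fst) (auto simp: space_pair_measure space_restrict_space)
  finally show ?thesis .
qed

text \<open>The cancellation could fail only where \<open>dens_L\<close> is 0 and
  \<open>dens_LA\<close> is not. The difference of the two sides is nonnegative, and its integral
  over a is g - g (g / g), which is 0 also for g = 0; hence it vanishes almost everywhere. This is
  why the mixture \<open>dens_A\<close> is the true treatment marginal.\<close>

lemma dens_LA_divide_dens_L:
  assumes q: "prob_density M q"
  shows "AE x in LA. dens_L q (fst x) * (dens_LA q x / dens_L q (fst x)) = dens_LA q x"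
proof -
  have [measurable]: "q \<in> borel_measurable M" and nn: "\<And>z. z \<in> space M \<Longrightarrow> 0 \<le> q z"
    using q by (auto simp: prob_density_def)
  let ?d = "\<lambda>x. dens_LA q x - dens_L q (fst x) * (dens_LA q x / dens_L q (fst x))"
  note i = dens_LA_integrable[OF prob_density_integrable(1)[OF q]]
  have id: "integrable LA ?d"
    by (rule Bochner_Integration.integrable_bound[OF i(1)]) auto
  have zero: "(\<integral>a. dens_LA q (l, a) - dens_L q l * (dens_LA q (l, a) / dens_L q l) \<partial>\<alpha>) = 0"
    if "integrable \<alpha> (\<lambda>a. dens_LA q (l, a))" for l
  proof -
    have "(\<integral>a. dens_LA q (l, a) - dens_L q l * (dens_LA q (l, a) / dens_L q l) \<partial>\<alpha>) = dens_L q l - dens_L q l * (dens_L q l / dens_L q l)"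
      using that unfolding dens_L_def
      by (subst Bochner_Integration.integral_diff) (auto simp del: times_divide_eq_right)
    then show ?thesis by simp
  qed
  have "(\<integral>x. ?d x \<partial>LA) = (\<integral>l. \<integral>a. ?d (l, a) \<partial>\<alpha> \<partial>NL)"
    by (rule LA.integral_fst'[OF id, symmetric])
  also have "\<dots> = (\<integral>l. 0 \<partial>NL)"
  proof (rule integral_cong_AE)
    show "AE l in NL. (\<integral>a. ?d (l, a) \<partial>\<alpha>) = 0"
      using i(3) by eventually_elim (simp only: fst_conv zero)
  qed measurable
  finally have "(\<integral>x. ?d x \<partial>LA) = 0" by simp
  moreover have "0 \<le> ?d x" if "x \<in> space LA" for x
    using dens_LA_nonneg[of q "fst x" "snd x"] nn that
    by (auto simp: space_pair_measure space_restrict_space)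
  ultimately have "AE x in LA. ?d x = 0"
    using id by (subst (asm) integral_nonneg_eq_0_iff_AE) auto
  then show ?thesis by eventually_elim simp
qed

lemma dens_A_AE:
  assumes q: "prob_density M q"
  shows "AE a in \<alpha>. dens_A q a = (\<integral>l. dens_LA q (l, a) \<partial>NL)"
proof -
  have [measurable]: "q \<in> borel_measurable M"
    using q by (auto simp: prob_density_def)
  have "AE a in \<alpha>. AE l in NL. dens_L q l * (dens_LA q (l, a) / dens_L q l) = dens_LA q (l, a)"
    using LA.AE_pair[OF dens_LA_divide_dens_L[OF q]] by (subst LA.AE_commute[symmetric]) auto
  then show ?thesis
    using AE_space by eventually_elim (auto simp: dens_A_def intro!: integral_cong_AE)
qed

lemma distr_law_A:
  assumes q: "prob_density M q"
  shows "distr (law M q) \<alpha> (\<lambda>z. fst (snd z)) = density \<alpha> (\<lambda>a. ennreal (dens_A q a))"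
proof -
  have [measurable]: "q \<in> borel_measurable M" and nn: "\<And>z. z \<in> space M \<Longrightarrow> 0 \<le> q z"
    using q by (auto simp: prob_density_def)
  have "distr (law M q) \<alpha> (\<lambda>z. fst (snd z)) = distr (distr (law M q) LA (\<lambda>z. (fst z, fst (snd z)))) \<alpha> snd"
    by (subst distr_distr) (auto simp: o_def)
  also have "\<dots> = density \<alpha> (\<lambda>a. ennreal (\<integral>l. dens_LA q (l, a) \<partial>NL))"
    unfolding distr_law_LA[OF q]
    using dens_LA_integrable(1)[OF prob_density_integrable(1)[OF q]] dens_LA_nonneg[OF nn]
    by (intro LA.distr_density_snd) (auto simp: space_pair_measure space_restrict_space)
  also have "\<dots> = density \<alpha> (\<lambda>a. ennreal (dens_A q a))"
    using dens_A_AE[OF q] by (intro density_cong) auto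
  finally show ?thesis .
qed

lemma outcome_mean_eq: "outcome_mean NY q l a = mean q (l, a)"
  by (simp add: outcome_mean_def outcome_density_def mean_def dens_LA_def)

lemma treatment_density_eq: "treatment_density AA NY q l a = dens_LA q (l, a) / dens_L q l"
  by (simp add: treatment_density_def dens_L_def dens_LA_def)

lemma covariate_integral:
  assumes q: "prob_density M q" and [measurable]: "f \<in> borel_measurable NL"
  shows "(\<integral>l. f l \<partial>covariate_law NL AA NY q) = (\<integral>l. dens_L q l * f l \<partial>NL)"
proof -
  have [measurable]: "q \<in> borel_measurable M" and nn: "\<And>z. z \<in> space M \<Longrightarrow> 0 \<le> q z"
    using q by (auto simp: prob_density_def)
  show ?thesis
    unfolding covariate_law_eq[OF q] using dens_L_nonneg[OF nn] by (subst integral_density) auto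
qed

lemma measurable_section:
  assumes "f \<in> borel_measurable LA" "a \<in> AA"
  shows "(\<lambda>l. f (l, a)) \<in> borel_measurable NL"
  by (rule measurable_compose[OF measurable_Pair2' assms(1)])
    (use assms(2) in \<open>simp add: space_restrict_space\<close>)

lemma marginal_treatment_density_eq:
  assumes q: "prob_density M q" and a: "a \<in> AA"
  shows "marginal_treatment_density NL AA NY q a = dens_A q a"
proof -
  have [measurable]: "q \<in> borel_measurable M"
    using q by (auto simp: prob_density_def)
  have [measurable]: "(\<lambda>l. dens_LA q (l, a)) \<in> borel_measurable NL"
    by (rule measurable_section[OF _ a]) measurable
  have "(\<lambda>l. dens_LA q (l, a) / dens_L q l) \<in> borel_measurable NL"
    by measurable
  then show ?thesis
    unfolding marginal_treatment_density_def treatment_density_eq dens_A_def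
    by (rule covariate_integral[OF q])
qed

text \<open>The density p(y | l, a) p(l) \<varpi>(a) of the law in which the treatment is redrawn
  from its marginal independently of the covariates. The parameter is the mean outcome under
  it.\<close>

definition weight :: "('l \<times> real \<times> real \<Rightarrow> real) \<Rightarrow> 'l \<times> real \<times> real \<Rightarrow> real" where
  "weight q z = q z / dens_LA q (fst z, fst (snd z)) * (dens_L q (fst z) * dens_A q (fst (snd z)))"

text \<open>Integrating out y turns y q / f into the conditional mean. The factor \<beta> is left
  free because it is g w in the parameter, but a variation of g, w or f in the derivative.\<close>

lemma mean_integral:
  assumes [measurable]: "\<beta> \<in> borel_measurable LA" "q \<in> borel_measurable M"
    and i: "integrable M (\<lambda>z. snd (snd z) * (q z / dens_LA q (fst z, fst (snd z)) * \<beta> (fst z, fst (snd z))))"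
  shows "integrable LA (\<lambda>x. mean q x * \<beta> x)"
    and "(\<integral>z. snd (snd z) * (q z / dens_LA q (fst z, fst (snd z)) * \<beta> (fst z, fst (snd z))) \<partial>M) =
      (\<integral>x. mean q x * \<beta> x \<partial>LA)"
proof -
  have "(\<integral>y. y * (q (fst x, snd x, y) / dens_LA q x * \<beta> x) \<partial>NY) =
      (\<integral>y. y * (q (fst x, snd x, y) / dens_LA q x) * \<beta> x \<partial>NY)" for x
    by (simp only: mult.assoc)
  \<comment> \<open>The factor \<beta> x can be pulled out even when the section is not integrable,
    both sides then being 0, so the identity holds at every x.\<close>
  then have eq: "(\<integral>y. y * (q (fst x, snd x, y) / dens_LA q x * \<beta> x) \<partial>NY) = mean q x * \<beta> x" for x
    by (simp only: mean_def integral_mult_left_zero)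
  show "integrable LA (\<lambda>x. mean q x * \<beta> x)"
    using integral_M(2)[OF i] by (simp only: fst_conv snd_conv eq prod.collapse)
  show "(\<integral>z. snd (snd z) * (q z / dens_LA q (fst z, fst (snd z)) * \<beta> (fst z, fst (snd z))) \<partial>M) =
      (\<integral>x. mean q x * \<beta> x \<partial>LA)"
    using integral_M(1)[OF i] by (simp only: fst_conv snd_conv eq prod.collapse)
qed

text \<open>Joint integrability licenses two uses of Fubini: integrating out the outcome, and
  changing to the order of \<open>psi\<close>, where the covariates are integrated before the
  treatment.\<close>

lemma psi_eq:
  assumes q: "prob_density M q" and i: "integrable M (\<lambda>z. snd (snd z) * weight q z)"
  shows "psi NL AA NY q = (\<integral>z. snd (snd z) * weight q z \<partial>M)"
proof -
  have [measurable]: "q \<in> borel_measurable M"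
    using q by (auto simp: prob_density_def)
  have m: "(\<lambda>l. mean q (l, a)) \<in> borel_measurable NL" if "a \<in> AA" for a
    by (rule measurable_section[OF _ that]) measurable
  let ?\<beta> = "\<lambda>x. dens_L q (fst x) * dens_A q (snd x)"
  have \<beta>: "integrable LA (\<lambda>x. mean q x * ?\<beta> x)"
    "(\<integral>z. snd (snd z) * weight q z \<partial>M) = (\<integral>x. mean q x * ?\<beta> x \<partial>LA)"
    using mean_integral[of ?\<beta> q] i unfolding weight_def by (simp_all only: fst_conv snd_conv) measurable
  have "psi NL AA NY q = (\<integral>a. \<integral>l. mean q (l, a) * ?\<beta> (l, a) \<partial>NL \<partial>\<alpha>)"
    unfolding psi_def
  proof (rule Bochner_Integration.integral_cong[OF refl])
    fix a assume "a \<in> space \<alpha>"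
    then have a: "a \<in> AA" by (simp add: space_restrict_space)
    show "(\<integral>l. outcome_mean NY q l a * marginal_treatment_density NL AA NY q a
        \<partial>covariate_law NL AA NY q) = (\<integral>l. mean q (l, a) * ?\<beta> (l, a) \<partial>NL)"
      unfolding outcome_mean_eq marginal_treatment_density_eq[OF q a] fst_conv snd_conv
      using covariate_integral[OF q borel_measurable_times[OF m[OF a] borel_measurable_const]]
      by (simp only: mult_ac)
  qed
  also have "\<dots> = (\<integral>x. mean q x * ?\<beta> x \<partial>LA)"
    using LA.integral_snd[of "\<lambda>l a. mean q (l, a) * ?\<beta> (l, a)"] \<beta>(1)
    by (simp only: case_prod_beta' prod.collapse)
  finally show ?thesis using \<beta>(2) by simp
qed

end

section \<open>Transferring factors between the joint density and its marginals\<close>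

context observation_space
begin

text \<open>Read from right to left, this returns the variation of a marginal to an integral over
  the data, which is how influence functions are read off.\<close>

lemma section_integral:
  assumes i: "integrable M (\<lambda>z. c z * \<beta> (fst z, fst (snd z)))"
  shows "integrable LA (\<lambda>x. dens_LA c x * \<beta> x)"
    and "(\<integral>z. c z * \<beta> (fst z, fst (snd z)) \<partial>M) = (\<integral>x. dens_LA c x * \<beta> x \<partial>LA)"
proof -
  have eq: "(\<integral>y. c (fst x, snd x, y) * \<beta> x \<partial>NY) = dens_LA c x * \<beta> x" for x
    by (simp only: dens_LA_def integral_mult_left_zero)
  show "integrable LA (\<lambda>x. dens_LA c x * \<beta> x)"
    using integral_M(2)[OF i] by (simp only: fst_conv snd_conv eq prod.collapse)
  show "(\<integral>z. c z * \<beta> (fst z, fst (snd z)) \<partial>M) = (\<integral>x. dens_LA c x * \<beta> x \<partial>LA)"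
    using integral_M(1)[OF i] by (simp only: fst_conv snd_conv eq prod.collapse)
qed

lemma LA_integral_fst:
  fixes h :: "'l \<times> real \<Rightarrow> real"
  assumes "integrable LA (\<lambda>x. h x * \<beta> (fst x))"
  shows "integrable NL (\<lambda>l. (\<integral>a. h (l, a) \<partial>\<alpha>) * \<beta> l)"
    "(\<integral>x. h x * \<beta> (fst x) \<partial>LA) = (\<integral>l. (\<integral>a. h (l, a) \<partial>\<alpha>) * \<beta> l \<partial>NL)"
  using LA.integrable_fst'[OF assms] LA.integral_fst'[OF assms]
  by (simp_all only: fst_conv integral_mult_left_zero)

lemma LA_integral_snd:
  fixes h :: "'l \<times> real \<Rightarrow> real"
  assumes "integrable LA (\<lambda>x. h x * \<beta> (snd x))"
  shows "integrable \<alpha> (\<lambda>a. (\<integral>l. h (l, a) \<partial>NL) * \<beta> a)"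
    "(\<integral>x. h x * \<beta> (snd x) \<partial>LA) = (\<integral>a. (\<integral>l. h (l, a) \<partial>NL) * \<beta> a \<partial>\<alpha>)"
  using LA.integrable_snd[of "\<lambda>l a. h (l, a) * \<beta> a"] LA.integral_snd[of "\<lambda>l a. h (l, a) * \<beta> a"] assms
  by (simp_all only: case_prod_beta' prod.collapse integral_mult_left_zero)

end

section \<open>The uncentred gradient at p and its integrability\<close>

locale observation = observation_space NL AA NY
  for NL :: "'l measure" and AA :: "real set" and NY :: "real measure" +
  fixes p :: "'l \<times> real \<times> real \<Rightarrow> real"
  assumes p: "prob_density M p"
    and mean_finite: "integrable M (\<lambda>z. snd (snd z) * weight p z)"
begin

lemma p_measurable [measurable]: "p \<in> borel_measurable M"
  using p by (simp add: prob_density_def)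

lemma p_nonneg: "z \<in> space M \<Longrightarrow> 0 \<le> p z"
  using p by (simp add: prob_density_def)

lemmas p_integrable = prob_density_integrable[OF p]

text \<open>This is \<varpi>(a) / \<pi>(a | l), the stabilised inverse probability weight. Written
  with one quotient by the joint density, it matches \<open>weight\<close>.\<close>

definition ratio :: "'l \<times> real \<Rightarrow> real" where
  "ratio x = dens_L p (fst x) * dens_A p (snd x) / dens_LA p x"

definition mean_A :: "real \<Rightarrow> real" where
  "mean_A a = (\<integral>l. mean p (l, a) * dens_L p l \<partial>NL)"

definition mean_L :: "'l \<Rightarrow> real" where
  "mean_L l = (\<integral>a. mean p (l, a) * dens_A p a \<partial>\<alpha>)"

lemma ratio_measurable [measurable]: "ratio \<in> borel_measurable LA"
  unfolding ratio_def by measurable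

lemma mean_A_measurable [measurable]: "mean_A \<in> borel_measurable \<alpha>"
  unfolding mean_A_def by measurable

lemma mean_L_measurable [measurable]: "mean_L \<in> borel_measurable NL"
  unfolding mean_L_def by measurable

definition gradient :: "'l \<times> real \<times> real \<Rightarrow> real" where
  "gradient z = snd (snd z) * ratio (fst z, fst (snd z))
     - mean p (fst z, fst (snd z)) * ratio (fst z, fst (snd z))
     + mean_A (fst (snd z)) + mean_L (fst z)"

lemma gradient_measurable [measurable]: "gradient \<in> borel_measurable M"
  unfolding gradient_def by measurable

lemma dens_LA_p_nonneg: "x \<in> space LA \<Longrightarrow> 0 \<le> dens_LA p x"
  using dens_LA_nonneg[of p "fst x" "snd x"] p_nonneg
  by (auto simp: space_pair_measure space_restrict_space)

lemma weight_nonneg: "z \<in> space M \<Longrightarrow> 0 \<le> weight p z"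
  unfolding weight_def using p_nonneg[of z] dens_LA_nonneg[OF p_nonneg] dens_L_nonneg[OF p_nonneg] dens_A_nonneg[OF p_nonneg]
  by (auto simp: space_M)

text \<open>Directions c are signed and define no law of their own; domination by a multiple of p
  lets them inherit integrability from the law of p.\<close>

lemma integrable_of_law:
  assumes H: "integrable (law M p) H"
    and [measurable]: "c \<in> borel_measurable M" and c: "\<And>z. z \<in> space M \<Longrightarrow> \<bar>c z\<bar> \<le> B * p z"
  shows "integrable M (\<lambda>z. c z * H z)"
proof -
  have [measurable]: "H \<in> borel_measurable M" using borel_measurable_integrable[OF H] by simp
  have "integrable M (\<lambda>z. p z * H z)"
    using H p_nonneg unfolding law_def by (subst (asm) integrable_density) auto
  then have "integrable M (\<lambda>z. B * (p z * H z))" by simp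
  then show ?thesis
  proof (rule Bochner_Integration.integrable_bound)
    show "AE z in M. norm (c z * H z) \<le> norm (B * (p z * H z))"
    proof (rule AE_I2)
      fix z assume z: "z \<in> space M"
      have "\<bar>c z\<bar> \<le> \<bar>B\<bar> * \<bar>p z\<bar>" using c[OF z] abs_ge_self[of "B * p z"] by (simp add: abs_mult)
      then show "norm (c z * H z) \<le> norm (B * (p z * H z))"
        using mult_right_mono[of "\<bar>c z\<bar>" "\<bar>B\<bar> * \<bar>p z\<bar>" "\<bar>H z\<bar>"] by (simp add: abs_mult mult_ac)
    qed
  qed measurable
qed

lemma law_integrable_LA:
  assumes [measurable]: "\<beta> \<in> borel_measurable LA" and i: "integrable LA (\<lambda>x. dens_LA p x * \<beta> x)"
  shows "integrable (law M p) (\<lambda>z. \<beta> (fst z, fst (snd z)))"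
proof -
  have "AE x in LA. 0 \<le> dens_LA p x" using dens_LA_p_nonneg by auto
  then have "integrable (density LA (\<lambda>x. ennreal (dens_LA p x))) \<beta>"
    using i by (subst integrable_density) auto
  then have "integrable (distr (law M p) LA (\<lambda>z. (fst z, fst (snd z)))) \<beta>"
    by (simp only: distr_law_LA[OF p])
  then show ?thesis by (subst (asm) integrable_distr_eq) auto
qed

lemma law_integrable_L:
  assumes [measurable]: "\<beta> \<in> borel_measurable NL" and i: "integrable NL (\<lambda>l. dens_L p l * \<beta> l)"
  shows "integrable (law M p) (\<lambda>z. \<beta> (fst z))"
proof -
  have "AE l in NL. 0 \<le> dens_L p l" using dens_L_nonneg[OF p_nonneg] by auto
  then have "integrable (density NL (\<lambda>l. ennreal (dens_L p l))) \<beta>"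
    using i by (subst integrable_density) auto
  then have "integrable (distr (law M p) NL fst) \<beta>"
    using covariate_law_eq[OF p] by (simp only: covariate_law_def)
  then show ?thesis by (subst (asm) integrable_distr_eq) auto
qed

lemma law_integrable_A:
  assumes [measurable]: "\<beta> \<in> borel_measurable \<alpha>" and i: "integrable \<alpha> (\<lambda>a. dens_A p a * \<beta> a)"
  shows "integrable (law M p) (\<lambda>z. \<beta> (fst (snd z)))"
proof -
  have "AE a in \<alpha>. 0 \<le> dens_A p a"
    using dens_A_nonneg[OF p_nonneg] by (intro AE_I2) (auto simp: space_restrict_space)
  then have "integrable (density \<alpha> (\<lambda>a. ennreal (dens_A p a))) \<beta>"
    using i by (subst integrable_density) auto
  then have "integrable (distr (law M p) \<alpha> (\<lambda>z. fst (snd z))) \<beta>"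
    by (simp only: distr_law_A[OF p])
  then show ?thesis by (subst (asm) integrable_distr_eq) auto
qed

lemma mean_weighted_integrable:
  "integrable LA (\<lambda>x. mean p x * (dens_L p (fst x) * dens_A p (snd x)))"
  "psi NL AA NY p = (\<integral>x. mean p x * (dens_L p (fst x) * dens_A p (snd x)) \<partial>LA)"
  using mean_integral[of "\<lambda>x. dens_L p (fst x) * dens_A p (snd x)" p] mean_finite psi_eq[OF p mean_finite]
  unfolding weight_def by (simp_all only: fst_conv snd_conv) measurable

lemma dens_L_mean_L_integrable: "integrable NL (\<lambda>l. dens_L p l * mean_L l)"
proof -
  have "integrable LA (\<lambda>x. (mean p x * dens_A p (snd x)) * dens_L p (fst x))"
    using mean_weighted_integrable(1) by (simp only: mult_ac)
  from LA_integral_fst(1)[OF this] show ?thesis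
    by (simp only: mean_L_def snd_conv mult.commute)
qed

lemma dens_A_mean_A_integrable:
  "integrable \<alpha> (\<lambda>a. dens_A p a * mean_A a)" "(\<integral>a. dens_A p a * mean_A a \<partial>\<alpha>) = psi NL AA NY p"
proof -
  have i: "integrable LA (\<lambda>x. (mean p x * dens_L p (fst x)) * dens_A p (snd x))"
    using mean_weighted_integrable(1) by (simp only: mult_ac)
  have "psi NL AA NY p = (\<integral>x. (mean p x * dens_L p (fst x)) * dens_A p (snd x) \<partial>LA)"
    unfolding mean_weighted_integrable(2) by (simp only: mult_ac)
  then show "integrable \<alpha> (\<lambda>a. dens_A p a * mean_A a)" "(\<integral>a. dens_A p a * mean_A a \<partial>\<alpha>) = psi NL AA NY p"
    using LA_integral_snd[OF i] by (simp_all only: mean_A_def fst_conv mult.commute)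
qed

lemma law_gradient_integrable:
  "integrable (law M p) (\<lambda>z. snd (snd z) * ratio (fst z, fst (snd z)))"
  "integrable (law M p) (\<lambda>z. mean p (fst z, fst (snd z)) * ratio (fst z, fst (snd z)))"
  "integrable (law M p) (\<lambda>z. mean_A (fst (snd z)))"
  "integrable (law M p) (\<lambda>z. mean_L (fst z))"
proof -
  have "AE z in M. 0 \<le> p z" using p_nonneg by auto
  moreover have "integrable M (\<lambda>z. p z * (snd (snd z) * ratio (fst z, fst (snd z))))"
    using mean_finite by (simp add: weight_def ratio_def mult_ac)
  ultimately show "integrable (law M p) (\<lambda>z. snd (snd z) * ratio (fst z, fst (snd z)))"
    unfolding law_def by (subst integrable_density) auto
  \<comment> \<open>The two occurrences of the joint density cancel only where it is nonzero, and
    elsewhere the product is 0; hence a bound and not an equality.\<close>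
  have "integrable LA (\<lambda>x. dens_LA p x * (mean p x * ratio x))"
    by (rule Bochner_Integration.integrable_bound[OF mean_weighted_integrable(1)])
      (auto simp: ratio_def)
  then show "integrable (law M p) (\<lambda>z. mean p (fst z, fst (snd z)) * ratio (fst z, fst (snd z)))"
    using law_integrable_LA[of "\<lambda>x. mean p x * ratio x"] by simp
  show "integrable (law M p) (\<lambda>z. mean_A (fst (snd z)))"
    by (rule law_integrable_A[OF mean_A_measurable dens_A_mean_A_integrable(1)])
  show "integrable (law M p) (\<lambda>z. mean_L (fst z))"
    by (rule law_integrable_L[OF mean_L_measurable dens_L_mean_L_integrable])
qed

lemma gradient_integrable: "integrable (law M p) gradient"
  unfolding gradient_def using law_gradient_integrable by auto

text \<open>The product rule for \<open>weight\<close> at p in direction c. The treatment term uses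
  the plain marginal of c and not \<open>dens_A c\<close>: for a signed c, \<open>dens_L c\<close>
  may vanish without \<open>dens_LA c\<close> doing so, and the quotient in \<open>dens_A\<close>
  would not cancel. The last term divides twice by the joint density, so that it keeps the form p /
  f times a function of (l, a) required by \<open>mean_integral\<close>.\<close>

definition weight_variation :: "('l \<times> real \<times> real \<Rightarrow> real) \<Rightarrow> 'l \<times> real \<times> real \<Rightarrow> real" where
  "weight_variation c z =
      c z / dens_LA p (fst z, fst (snd z)) * (dens_L p (fst z) * dens_A p (fst (snd z)))
      + p z / dens_LA p (fst z, fst (snd z)) * (dens_L c (fst z) * dens_A p (fst (snd z)))
      + p z / dens_LA p (fst z, fst (snd z)) * (dens_L p (fst z) * (\<integral>l. dens_LA c (l, fst (snd z)) \<partial>NL))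
      - p z / dens_LA p (fst z, fst (snd z)) *
          (dens_LA c (fst z, fst (snd z)) / dens_LA p (fst z, fst (snd z)) * (dens_L p (fst z) * dens_A p (fst (snd z))))"

lemma weight_variation_measurable [measurable]:
  assumes [measurable]: "c \<in> borel_measurable M"
  shows "weight_variation c \<in> borel_measurable M"
proof -
  have [measurable]: "(\<lambda>z. \<integral>l. dens_LA c (l, fst (snd z)) \<partial>NL) \<in> borel_measurable M"
    by (rule measurable_compose[of "\<lambda>z. fst (snd z)" M \<alpha>]) measurable
  show ?thesis unfolding weight_variation_def by measurable
qed

section \<open>Directions dominated by p and the gradient as adjoint\<close>

context
  fixes c :: "'l \<times> real \<times> real \<Rightarrow> real" and B :: real
  assumes c_measurable [measurable]: "c \<in> borel_measurable M"
    and B_nonneg: "0 \<le> B"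
    and c_bound: "\<And>z. z \<in> space M \<Longrightarrow> \<bar>c z\<bar> \<le> B * p z"
begin

lemma c_integrable: "integrable M c"
  using integrable_of_law[of "\<lambda>_. 1" c B] c_bound p
  by (simp add: law_def integrable_density p_integrable prob_density_def)

lemma dens_LA_bound: "AE x in LA. \<bar>dens_LA c x\<bar> \<le> B * dens_LA p x"
  using integral_M(3)[OF c_integrable] integral_M(3)[OF p_integrable(1)] AE_space
proof eventually_elim
  case (elim x)
  have "\<bar>dens_LA c x\<bar> \<le> (\<integral>y. \<bar>c (fst x, snd x, y)\<bar> \<partial>NY)"
    unfolding dens_LA_def by (rule integral_abs_bound)
  also have "\<dots> \<le> (\<integral>y. B * p (fst x, snd x, y) \<partial>NY)"
    using elim c_bound
    by (intro integral_mono) (auto simp: space_M space_pair_measure space_restrict_space)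
  finally show ?case by (simp add: dens_LA_def)
qed

lemma dens_L_bound: "AE l in NL. \<bar>dens_L c l\<bar> \<le> B * dens_L p l"
  using dens_LA_integrable(3)[OF c_integrable] dens_LA_integrable(3)[OF p_integrable(1)] LA.AE_pair[OF dens_LA_bound]
proof eventually_elim
  case (elim l)
  have "\<bar>dens_L c l\<bar> \<le> (\<integral>a. \<bar>dens_LA c (l, a)\<bar> \<partial>\<alpha>)"
    unfolding dens_L_def by (rule integral_abs_bound)
  also have "\<dots> \<le> (\<integral>a. B * dens_LA p (l, a) \<partial>\<alpha>)"
    using elim by (intro integral_mono_AE) auto
  finally show ?case by (simp add: dens_L_def)
qed

lemma dens_A_bound: "AE a in \<alpha>. \<bar>\<integral>l. dens_LA c (l, a) \<partial>NL\<bar> \<le> B * dens_A p a"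
proof -
  have [measurable]: "(\<lambda>x. \<bar>dens_LA c x\<bar> \<le> B * dens_LA p x) \<in> measurable LA (count_space UNIV)"
    by measurable
  have "AE a in \<alpha>. AE l in NL. \<bar>dens_LA c (l, a)\<bar> \<le> B * dens_LA p (l, a)"
    using LA.AE_pair[OF dens_LA_bound] by (subst LA.AE_commute[symmetric]) auto
  moreover have "AE a in \<alpha>. integrable NL (\<lambda>l. dens_LA c (l, a))" "AE a in \<alpha>. integrable NL (\<lambda>l. dens_LA p (l, a))"
    using LA.AE_integrable_snd[of "\<lambda>l a. dens_LA c (l, a)"] dens_LA_integrable(1)[OF c_integrable]
     LA.AE_integrable_snd[of "\<lambda>l a. dens_LA p (l, a)"] dens_LA_integrable(1)[OF p_integrable(1)] by auto
  ultimately show ?thesis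
    using dens_A_AE[OF p]
  proof eventually_elim
    case (elim a)
    have "\<bar>\<integral>l. dens_LA c (l, a) \<partial>NL\<bar> \<le> (\<integral>l. \<bar>dens_LA c (l, a)\<bar> \<partial>NL)"
      by (rule integral_abs_bound)
    also have "\<dots> \<le> (\<integral>l. B * dens_LA p (l, a) \<partial>NL)"
      using elim by (intro integral_mono_AE) auto
    finally show ?case using elim by simp
  qed
qed

text \<open>A factor dominated by g w costs only a constant compared with \<open>weight\<close>, so
  the single finiteness assumption covers the variations of g, w and f alike.\<close>

lemma outcome_weight_integrable:
  assumes [measurable]: "\<beta> \<in> borel_measurable LA"
    and \<beta>: "AE x in LA. \<bar>\<beta> x\<bar> \<le> B * (dens_L p (fst x) * dens_A p (snd x))"
  shows "integrable M (\<lambda>z. snd (snd z) * (p z / dens_LA p (fst z, fst (snd z)) * \<beta> (fst z, fst (snd z))))"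
proof -
  have "integrable M (\<lambda>z. B * (snd (snd z) * weight p z))"
    using mean_finite by simp
  then show ?thesis
  proof (rule Bochner_Integration.integrable_bound)
    show "AE z in M. norm (snd (snd z) * (p z / dens_LA p (fst z, fst (snd z)) * \<beta> (fst z, fst (snd z))))
        \<le> norm (B * (snd (snd z) * weight p z))"
      using AE_M_LA[OF \<beta>]
    proof eventually_elim
      case (elim z)
      have "\<bar>\<beta> (fst z, fst (snd z))\<bar> \<le> \<bar>B * (dens_L p (fst z) * dens_A p (fst (snd z)))\<bar>"
        using elim by simp
      from mult_left_mono[OF this abs_ge_zero[of "snd (snd z) * (p z / dens_LA p (fst z, fst (snd z)))"]]
      show ?case by (simp add: weight_def abs_mult mult_ac)
    qed
  qed measurable
qed

text \<open>Each variation of a marginal is itself an integral of c, so Fubini moves it off the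
  marginal and onto c. It is used with c the derivative of a submodel, and with c = p to compute the
  mean of the gradient.\<close>

lemma gradient_identity:
  "(\<integral>z. snd (snd z) * weight_variation c z \<partial>M) = (\<integral>z. c z * gradient z \<partial>M)"
proof -
  let ?x = "\<lambda>z :: 'l \<times> real \<times> real. (fst z, fst (snd z))"
  let ?v = "\<lambda>a. \<integral>l. dens_LA c (l, a) \<partial>NL"
  let ?\<beta>2 = "\<lambda>x. dens_L c (fst x) * dens_A p (snd x)"
  let ?\<beta>3 = "\<lambda>x. dens_L p (fst x) * ?v (snd x)"
  let ?\<beta>4 = "\<lambda>x. dens_LA c x / dens_LA p x * (dens_L p (fst x) * dens_A p (snd x))"
  have VN: "AE x in LA. 0 \<le> dens_A p (snd x)" and GN: "AE x in LA. 0 \<le> dens_L p (fst x)"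
    using dens_A_nonneg[OF p_nonneg] dens_L_nonneg[OF p_nonneg]
    by (auto intro!: AE_I2 simp: space_pair_measure space_restrict_space)
  have b2: "AE x in LA. \<bar>?\<beta>2 x\<bar> \<le> B * (dens_L p (fst x) * dens_A p (snd x))"
    using LA.AE_fst[OF dens_L_bound] VN
  proof eventually_elim
    case (elim x)
    from mult_right_mono[OF elim] show ?case using elim by (simp add: abs_mult mult_ac)
  qed
  have b3: "AE x in LA. \<bar>?\<beta>3 x\<bar> \<le> B * (dens_L p (fst x) * dens_A p (snd x))"
    using LA.AE_snd[OF dens_A_bound] GN
  proof eventually_elim
    case (elim x)
    from mult_left_mono[OF elim] show ?case using elim by (simp add: abs_mult mult_ac)
  qed
  have b4: "AE x in LA. \<bar>?\<beta>4 x\<bar> \<le> B * (dens_L p (fst x) * dens_A p (snd x))"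
    using dens_LA_bound GN VN AE_space
  proof eventually_elim
    case (elim x)
    \<comment> \<open>Where \<open>dens_LA p x = 0\<close> the quotient is 0, and the bound reduces
      to B \<ge> 0.\<close>
    have "\<bar>dens_LA c x / dens_LA p x\<bar> \<le> B"
      using elim(1) dens_LA_p_nonneg[OF elim(4)] B_nonneg
      by (cases "dens_LA p x = 0") (simp_all add: abs_divide pos_divide_le_eq)
    from mult_right_mono[OF this, of "dens_L p (fst x) * dens_A p (snd x)"]
    show ?case using elim by (simp add: abs_mult)
  qed
  have [measurable]: "?\<beta>2 \<in> borel_measurable LA" "?\<beta>3 \<in> borel_measurable LA"
    "?\<beta>4 \<in> borel_measurable LA"
    by measurable
  note i2 = outcome_weight_integrable[OF _ b2] and i3 = outcome_weight_integrable[OF _ b3]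
    and i4 = outcome_weight_integrable[OF _ b4]
  note m2 = mean_integral[OF _ _ i2] and m3 = mean_integral[OF _ _ i3] and m4 = mean_integral[OF _ _ i4]
  note j = law_gradient_integrable[THEN integrable_of_law, OF c_measurable c_bound]
  have i1: "integrable M (\<lambda>z. snd (snd z) * (c z / dens_LA p (?x z) * (dens_L p (fst z) * dens_A p (fst (snd z)))))"
    and e1: "(\<integral>z. snd (snd z) * (c z / dens_LA p (?x z) * (dens_L p (fst z) * dens_A p (fst (snd z)))) \<partial>M) =
       (\<integral>z. c z * (snd (snd z) * ratio (?x z)) \<partial>M)"
    using j(1) by (simp_all add: ratio_def mult_ac)
  \<comment> \<open>Integrating out the outcome and then the treatment leaves \<open>mean_L\<close>
    against \<open>dens_L c\<close>, which is expanded again into an integral of c. The treatment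
    marginal is handled likewise, with \<open>mean_A\<close>.\<close>
  have e2: "(\<integral>z. snd (snd z) * (p z / dens_LA p (?x z) * (dens_L c (fst z) * dens_A p (fst (snd z)))) \<partial>M) =
       (\<integral>z. c z * mean_L (fst z) \<partial>M)"
  proof -
    have k: "integrable LA (\<lambda>x. (mean p x * dens_A p (snd x)) * dens_L c (fst x))"
      using m2(1) by (simp add: mult_ac)
    have "(\<integral>z. snd (snd z) * (p z / dens_LA p (?x z) * (dens_L c (fst z) * dens_A p (fst (snd z)))) \<partial>M) =
        (\<integral>x. (mean p x * dens_A p (snd x)) * dens_L c (fst x) \<partial>LA)"
      using m2(2) by (simp add: mult_ac)
    also have "\<dots> = (\<integral>l. mean_L l * dens_L c l \<partial>NL)"
      using LA_integral_fst(2)[OF k] by (simp add: mean_L_def)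
    also have "\<dots> = (\<integral>x. dens_LA c x * mean_L (fst x) \<partial>LA)"
      using LA_integral_fst(2)[of "dens_LA c" mean_L] section_integral(1)[of c "\<lambda>x. mean_L (fst x)"] j(4)
      by (simp add: dens_L_def mult_ac)
    also have "\<dots> = (\<integral>z. c z * mean_L (fst z) \<partial>M)"
      using section_integral(2)[of c "\<lambda>x. mean_L (fst x)"] j(4) by simp
    finally show ?thesis .
  qed
  have e3: "(\<integral>z. snd (snd z) * (p z / dens_LA p (?x z) * (dens_L p (fst z) * ?v (fst (snd z)))) \<partial>M) =
       (\<integral>z. c z * mean_A (fst (snd z)) \<partial>M)"
  proof -
    have k: "integrable LA (\<lambda>x. (mean p x * dens_L p (fst x)) * ?v (snd x))"
      using m3(1) by (simp add: mult_ac)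
    have "(\<integral>z. snd (snd z) * (p z / dens_LA p (?x z) * (dens_L p (fst z) * ?v (fst (snd z)))) \<partial>M) =
        (\<integral>x. (mean p x * dens_L p (fst x)) * ?v (snd x) \<partial>LA)"
      using m3(2) by (simp add: mult_ac)
    also have "\<dots> = (\<integral>a. mean_A a * ?v a \<partial>\<alpha>)"
      using LA_integral_snd(2)[OF k] by (simp add: mean_A_def)
    also have "\<dots> = (\<integral>x. dens_LA c x * mean_A (snd x) \<partial>LA)"
      using LA_integral_snd(2)[of "dens_LA c" mean_A] section_integral(1)[of c "\<lambda>x. mean_A (snd x)"] j(3)
      by (simp add: mult_ac)
    also have "\<dots> = (\<integral>z. c z * mean_A (fst (snd z)) \<partial>M)"
      using section_integral(2)[of c "\<lambda>x. mean_A (snd x)"] j(3) by simp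
    finally show ?thesis .
  qed
  \<comment> \<open>The joint density depends on covariates and treatment together, so only the
    outcome is integrated out; the quotient by f turns g w into \<open>ratio\<close>.\<close>
  have e4: "(\<integral>z. snd (snd z) * (p z / dens_LA p (?x z) *
        (dens_LA c (?x z) / dens_LA p (?x z) * (dens_L p (fst z) * dens_A p (fst (snd z))))) \<partial>M) =
       (\<integral>z. c z * (mean p (?x z) * ratio (?x z)) \<partial>M)"
  proof -
    have "(\<integral>z. snd (snd z) * (p z / dens_LA p (?x z) *
        (dens_LA c (?x z) / dens_LA p (?x z) * (dens_L p (fst z) * dens_A p (fst (snd z))))) \<partial>M) =
        (\<integral>x. mean p x * ?\<beta>4 x \<partial>LA)"
      using m4(2) by simp
    also have "\<dots> = (\<integral>x. dens_LA c x * (mean p x * ratio x) \<partial>LA)"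
      by (simp add: ratio_def mult_ac)
    also have "\<dots> = (\<integral>z. c z * (mean p (?x z) * ratio (?x z)) \<partial>M)"
      using section_integral(2)[of c "\<lambda>x. mean p x * ratio x"] j(2) by simp
    finally show ?thesis .
  qed
  let ?T1 = "\<lambda>z. snd (snd z) * (c z / dens_LA p (?x z) * (dens_L p (fst z) * dens_A p (fst (snd z))))"
  let ?T2 = "\<lambda>z. snd (snd z) * (p z / dens_LA p (?x z) * (dens_L c (fst z) * dens_A p (fst (snd z))))"
  let ?T3 = "\<lambda>z. snd (snd z) * (p z / dens_LA p (?x z) * (dens_L p (fst z) * ?v (fst (snd z))))"
  let ?T4 = "\<lambda>z. snd (snd z) * (p z / dens_LA p (?x z) *
        (dens_LA c (?x z) / dens_LA p (?x z) * (dens_L p (fst z) * dens_A p (fst (snd z)))))"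
  have T: "integrable M ?T1" "integrable M ?T2" "integrable M ?T3" "integrable M ?T4"
    using i1 i2 i3 i4 by (simp_all only: fst_conv snd_conv) measurable
  have "(\<integral>z. ?T1 z + ?T2 z + ?T3 z - ?T4 z \<partial>M) =
      (\<integral>z. ?T1 z \<partial>M) + (\<integral>z. ?T2 z \<partial>M) + (\<integral>z. ?T3 z \<partial>M) - (\<integral>z. ?T4 z \<partial>M)"
    by (simp only: Bochner_Integration.integral_diff Bochner_Integration.integral_add
        Bochner_Integration.integrable_add T)
  also have "\<dots> = (\<integral>z. c z * (snd (snd z) * ratio (?x z)) \<partial>M) + (\<integral>z. c z * mean_L (fst z) \<partial>M)
      + (\<integral>z. c z * mean_A (fst (snd z)) \<partial>M) - (\<integral>z. c z * (mean p (?x z) * ratio (?x z)) \<partial>M)"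
    by (simp only: e1 e2 e3 e4)
  also have "\<dots> = (\<integral>z. c z * (snd (snd z) * ratio (?x z)) + c z * mean_L (fst z)
      + c z * mean_A (fst (snd z)) - c z * (mean p (?x z) * ratio (?x z)) \<partial>M)"
    by (simp only: Bochner_Integration.integral_diff Bochner_Integration.integral_add
        Bochner_Integration.integrable_add j)
  also have "\<dots> = (\<integral>z. c z * gradient z \<partial>M)"
    by (rule Bochner_Integration.integral_cong[OF refl]) (simp only: gradient_def algebra_simps)
  finally show ?thesis
    by (simp only: weight_variation_def distrib_left right_diff_distrib)
qed

end

end

section \<open>Tame paths of the marginals and of the weight\<close>

context observation_space
begin

text \<open>All marginals integrate over the underlying spaces only. This allows a submodel to be
  altered outside \<open>space M\<close>.\<close>

lemma weight_cong:
  assumes "\<And>z. z \<in> space M \<Longrightarrow> q z = q' z" "z \<in> space M"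
  shows "weight q z = weight q' z"
proof -
  have dens_LA: "dens_LA q (l, a) = dens_LA q' (l, a)" if "l \<in> space NL" "a \<in> AA" for l a
    unfolding dens_LA_def using assms(1) that
    by (intro Bochner_Integration.integral_cong) (auto simp: space_M)
  have dens_L: "dens_L q l = dens_L q' l" if "l \<in> space NL" for l
    unfolding dens_L_def using dens_LA that
    by (intro Bochner_Integration.integral_cong) (auto simp: space_restrict_space)
  have dens_A: "dens_A q a = dens_A q' a" if "a \<in> AA" for a
    unfolding dens_A_def using dens_LA dens_L that
    by (intro Bochner_Integration.integral_cong) auto
  show ?thesis
    using assms dens_LA dens_L dens_A by (auto simp: weight_def space_M)
qed

lemma tame_dens_LA:
  assumes "tame_path M q"
  shows "tame_path LA (\<lambda>\<epsilon>. dens_LA (q \<epsilon>))"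
  using tame_path_integral[OF tame_path_comp[OF assms measurable_M_assoc] Y.sigma_finite_measure_axioms]
  by (simp add: dens_LA_def[abs_def])

lemma tame_dens_L:
  assumes "tame_path M q"
  shows "tame_path NL (\<lambda>\<epsilon>. dens_L (q \<epsilon>))"
  using tame_path_integral[OF tame_dens_LA[OF assms] A.sigma_finite_measure_axioms]
  by (simp add: dens_L_def[abs_def])

text \<open>The coordinates are swapped because \<open>tame_path_integral\<close> integrates out the
  second one, here the covariates.\<close>

lemma tame_mixture:
  assumes "tame_path M q"
  shows "tame_path (\<alpha> \<Otimes>\<^sub>M NL)
    (\<lambda>\<epsilon> x. dens_L (q \<epsilon>) (snd x) * (dens_LA (q \<epsilon>) (snd x, fst x) / dens_L (q \<epsilon>) (snd x)))"
  by (intro tame_path_mult tame_path_divide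
      tame_path_comp[OF tame_dens_L[OF assms], of snd] tame_path_comp[OF tame_dens_LA[OF assms], of "\<lambda>x. (snd x, fst x)"])
    measurable

lemma tame_dens_A:
  assumes "tame_path M q"
  shows "tame_path \<alpha> (\<lambda>\<epsilon>. dens_A (q \<epsilon>))"
  using tame_path_integral[OF tame_mixture[OF assms] L.sigma_finite_measure_axioms]
  by (simp add: dens_A_def[abs_def])

lemma tame_weight:
  assumes "tame_path M q"
  shows "tame_path M (\<lambda>\<epsilon>. weight (q \<epsilon>))"
  unfolding weight_def[abs_def]
  by (intro tame_path_mult tame_path_divide assms
      tame_path_comp[OF tame_dens_L[OF assms], of fst] tame_path_comp[OF tame_dens_A[OF assms], of "\<lambda>z. fst (snd z)"]
      tame_path_comp[OF tame_dens_LA[OF assms], of "\<lambda>z. (fst z, fst (snd z))"])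
    measurable

text \<open>Only \<open>dens_LA\<close> occurs as a denominator. Where it vanishes at p it vanishes
  for all small \<epsilon>, so the weight is locally 0 and every term on the right is 0 by
  convention; elsewhere the usual rules apply.\<close>

lemma path_deriv_weight:
  fixes q :: "real \<Rightarrow> 'l \<times> real \<times> real \<Rightarrow> real"
  assumes q: "tame_path M q" and z: "z \<in> space M"
  defines "l \<equiv> fst z" and "a \<equiv> fst (snd z)" and "p \<equiv> q 0"
  shows "path_deriv (\<lambda>\<epsilon>. weight (q \<epsilon>)) z =
    path_deriv q z / dens_LA p (l, a) * (dens_L p l * dens_A p a)
    + p z / dens_LA p (l, a) * (path_deriv (\<lambda>\<epsilon>. dens_L (q \<epsilon>)) l * dens_A p a)
    + p z / dens_LA p (l, a) * (dens_L p l * path_deriv (\<lambda>\<epsilon>. dens_A (q \<epsilon>)) a)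
    - p z / dens_LA p (l, a) * (path_deriv (\<lambda>\<epsilon>. dens_LA (q \<epsilon>)) (l, a) / dens_LA p (l, a) * (dens_L p l * dens_A p a))"
    (is "_ = ?r")
proof -
  have l: "l \<in> space NL" and a: "a \<in> space \<alpha>" and x: "(l, a) \<in> space LA"
    using z by (auto simp: l_def a_def space_M space_pair_measure space_restrict_space)
  note dq = tame_path_has_deriv[OF q z]
    and dF = tame_path_has_deriv[OF tame_dens_LA[OF q] x]
    and dG = tame_path_has_deriv[OF tame_dens_L[OF q] l]
    and dV = tame_path_has_deriv[OF tame_dens_A[OF q] a]
  show ?thesis
  proof (cases "dens_LA p (l, a) = 0")
    case True
    have "\<forall>\<^sub>F \<epsilon> in nhds 0. dens_LA (q \<epsilon>) (l, a) = 0"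
      using tame_path_eventually_zero[OF tame_dens_LA[OF q] x] True by (simp add: p_def)
    then have "\<forall>\<^sub>F \<epsilon> in nhds 0. weight (q \<epsilon>) z = 0"
      by eventually_elim (simp add: weight_def l_def a_def)
    then have "path_deriv (\<lambda>\<epsilon>. weight (q \<epsilon>)) z = 0" by (rule path_deriv_eq_0)
    then show ?thesis using True by simp
  next
    case False
    have "((\<lambda>\<epsilon>. q \<epsilon> z / dens_LA (q \<epsilon>) (l, a) * (dens_L (q \<epsilon>) l * dens_A (q \<epsilon>) a)) has_real_derivative ?r) (at 0)"
      using False
      by (auto intro!: derivative_eq_intros dq dF dG dV simp: p_def field_simps)
    then show ?thesis
      unfolding path_deriv_def weight_def l_def[symmetric] a_def[symmetric]
      by (intro DERIV_imp_deriv)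
  qed
qed

end

section \<open>Derivative of the weighted outcome along a path\<close>

context observation
begin

context
  fixes q :: "real \<Rightarrow> 'l \<times> real \<times> real \<Rightarrow> real"
  assumes tame: "tame_path M q" and q0: "q 0 = p"
begin

lemma path_deriv_dens_LA: "AE x in LA. path_deriv (\<lambda>\<epsilon>. dens_LA (q \<epsilon>)) x = dens_LA (path_deriv q) x"
  using integral_M(3)[OF p_integrable(1)] AE_space
proof eventually_elim
  case (elim x)
  show ?case
    using path_deriv_integral[OF tame_path_comp[OF tame measurable_M_assoc] elim(2)] elim(1)
    by (simp add: dens_LA_def[abs_def] q0 path_deriv_def)
qed

lemma path_deriv_dens_L: "AE l in NL. path_deriv (\<lambda>\<epsilon>. dens_L (q \<epsilon>)) l = dens_L (path_deriv q) l"
proof -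
  note [measurable] = path_deriv_measurable[OF tame] path_deriv_measurable[OF tame_dens_LA[OF tame]]
  show ?thesis
    using dens_LA_integrable(3)[OF p_integrable(1)] LA.AE_pair[OF path_deriv_dens_LA] AE_space
  proof eventually_elim
    case (elim l)
    note [measurable] = elim(3)
    have "path_deriv (\<lambda>\<epsilon>. dens_L (q \<epsilon>)) l = (\<integral>a. path_deriv (\<lambda>\<epsilon>. dens_LA (q \<epsilon>)) (l, a) \<partial>\<alpha>)"
      using path_deriv_integral[OF tame_dens_LA[OF tame] elim(3)] elim(1) by (simp add: dens_L_def[abs_def] q0)
    also have "\<dots> = (\<integral>a. dens_LA (path_deriv q) (l, a) \<partial>\<alpha>)"
      using elim(2) by (intro integral_cong_AE) auto
    finally show ?case by (simp add: dens_L_def)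
  qed
qed

text \<open>Cancellation at \<epsilon> = 0 extends to small \<epsilon>. If the covariate density is
  nonzero it stays so by continuity; if it is 0, the assumption makes the joint density 0 as well,
  and both remain 0.\<close>

lemma path_deriv_mixture:
  assumes "x \<in> space LA" and "dens_L p (fst x) * (dens_LA p x / dens_L p (fst x)) = dens_LA p x"
  shows "path_deriv (\<lambda>\<epsilon> x. dens_L (q \<epsilon>) (snd x) * (dens_LA (q \<epsilon>) (snd x, fst x) / dens_L (q \<epsilon>) (snd x))) (snd x, fst x) =
    path_deriv (\<lambda>\<epsilon>. dens_LA (q \<epsilon>)) x"
proof (cases "dens_L p (fst x) = 0")
  case True
  have l: "fst x \<in> space NL" using assms(1) by (auto simp: space_pair_measure)
  have F0: "dens_LA p x = 0" using assms(2) True by simp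
  have "\<forall>\<^sub>F \<epsilon> in nhds 0. dens_L (q \<epsilon>) (fst x) = 0"
    using tame_path_eventually_zero[OF tame_dens_L[OF tame] l] True q0 by simp
  then have "path_deriv (\<lambda>\<epsilon> x. dens_L (q \<epsilon>) (snd x) * (dens_LA (q \<epsilon>) (snd x, fst x) / dens_L (q \<epsilon>) (snd x)))
      (snd x, fst x) = 0"
    by (intro path_deriv_eq_0) (auto elim!: eventually_mono)
  moreover have "path_deriv (\<lambda>\<epsilon>. dens_LA (q \<epsilon>)) x = 0"
    using tame_path_eventually_zero[OF tame_dens_LA[OF tame] assms(1)] F0 q0
    by (intro path_deriv_eq_0) auto
  ultimately show ?thesis by simp
next
  case False
  have l: "fst x \<in> space NL" using assms(1) by (auto simp: space_pair_measure)
  have "((\<lambda>\<epsilon>. dens_L (q \<epsilon>) (fst x)) \<longlongrightarrow> dens_L (q 0) (fst x)) (at 0)"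
    using DERIV_isCont[OF tame_path_has_deriv[OF tame_dens_L[OF tame] l]] by (simp add: isCont_def)
  then have "\<forall>\<^sub>F \<epsilon> in at 0. dens_L (q \<epsilon>) (fst x) \<noteq> 0"
    using False q0 by (intro tendsto_imp_eventually_ne) auto
  then have "\<forall>\<^sub>F \<epsilon> in nhds 0. dens_L (q \<epsilon>) (fst x) \<noteq> 0"
    using False q0 by (auto simp: eventually_at_filter elim!: eventually_mono)
  then have "\<forall>\<^sub>F \<epsilon> in nhds 0. dens_LA (q \<epsilon>) x = dens_L (q \<epsilon>) (fst x) * (dens_LA (q \<epsilon>) x / dens_L (q \<epsilon>) (fst x))"
    by eventually_elim simp
  from DERIV_cong_ev[OF refl this refl] tame_path_has_deriv[OF tame_dens_LA[OF tame] assms(1)]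
  have "((\<lambda>\<epsilon>. dens_L (q \<epsilon>) (fst x) * (dens_LA (q \<epsilon>) x / dens_L (q \<epsilon>) (fst x))) has_real_derivative
      path_deriv (\<lambda>\<epsilon>. dens_LA (q \<epsilon>)) x) (at 0)"
    by blast
  from DERIV_imp_deriv[OF this] show ?thesis
    by (simp only: path_deriv_def fst_conv snd_conv prod.collapse)
qed

lemma path_deriv_dens_A:
  "AE a in \<alpha>. path_deriv (\<lambda>\<epsilon>. dens_A (q \<epsilon>)) a = (\<integral>l. dens_LA (path_deriv q) (l, a) \<partial>NL)"
proof -
  let ?m = "\<lambda>\<epsilon> x. dens_L (q \<epsilon>) (snd x) * (dens_LA (q \<epsilon>) (snd x, fst x) / dens_L (q \<epsilon>) (snd x))"
  note [measurable] = path_deriv_measurable[OF tame] path_deriv_measurable[OF tame_dens_LA[OF tame]]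
    path_deriv_measurable[OF tame_mixture[OF tame]]
  have "AE x in LA. path_deriv ?m (snd x, fst x) = dens_LA (path_deriv q) x"
    using path_deriv_dens_LA dens_LA_divide_dens_L[OF p] AE_space
    by eventually_elim (use path_deriv_mixture in auto)
  then have sec: "AE l in NL. AE a in \<alpha>. path_deriv ?m (a, l) = dens_LA (path_deriv q) (l, a)"
    using LA.AE_pair[of "\<lambda>x. path_deriv ?m (snd x, fst x) = dens_LA (path_deriv q) x"]
    by (simp only: fst_conv snd_conv)
  \<comment> \<open>Exchanging the two almost-everywhere quantifiers requires the set of good points
    to be measurable in the product.\<close>
  have "{x \<in> space LA. path_deriv ?m (snd x, fst x) = dens_LA (path_deriv q) (fst x, snd x)} \<in> sets LA"
    by measurable
  from LA.AE_commute[of "\<lambda>l a. path_deriv ?m (a, l) = dens_LA (path_deriv q) (l, a)", OF this] sec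
  have eq: "AE a in \<alpha>. AE l in NL. path_deriv ?m (a, l) = dens_LA (path_deriv q) (l, a)"
    by (rule iffD1)
  have "AE a in \<alpha>. integrable NL (\<lambda>l. dens_LA p (l, a))"
    using LA.AE_integrable_snd[of "\<lambda>l a. dens_LA p (l, a)"] dens_LA_integrable(1)[OF p_integrable(1)] by simp
  then show ?thesis
    using eq AE_space
  proof eventually_elim
    case (elim a)
    have a: "a \<in> AA" using elim(3) by (simp add: space_restrict_space)
    have Fm [measurable]: "(\<lambda>l. dens_LA p (l, a)) \<in> borel_measurable NL"
      "(\<lambda>l. dens_LA (path_deriv q) (l, a)) \<in> borel_measurable NL"
      by (rule measurable_section[OF dens_LA_measurable[OF p_measurable] a]
          measurable_section[OF dens_LA_measurable[OF path_deriv_measurable[OF tame]] a])+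
    have dm: "(\<lambda>l. path_deriv ?m (a, l)) \<in> borel_measurable NL"
      by (rule measurable_compose[OF measurable_Pair1'[OF elim(3)]
            path_deriv_measurable[OF tame_mixture[OF tame]]])
    have "integrable NL (\<lambda>l. ?m 0 (a, l))"
      by (rule Bochner_Integration.integrable_bound[OF elim(1)]) (auto simp: q0)
    then have "path_deriv (\<lambda>\<epsilon>. dens_A (q \<epsilon>)) a = (\<integral>l. path_deriv ?m (a, l) \<partial>NL)"
      using path_deriv_integral[OF tame_mixture[OF tame] elim(3)] by (simp add: dens_A_def[abs_def])
    also have "\<dots> = (\<integral>l. dens_LA (path_deriv q) (l, a) \<partial>NL)"
      by (intro integral_cong_AE dm Fm(2) elim(2))
    finally show ?case .
  qed
qed

lemma weight_integral_has_derivative: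
  "((\<lambda>\<epsilon>. \<integral>z. snd (snd z) * weight (q \<epsilon>) z \<partial>M) has_real_derivative
     (\<integral>z. path_deriv q z * gradient z \<partial>M)) (at 0)"
proof -
  obtain B where B: "B \<ge> 0" "\<And>z. z \<in> space M \<Longrightarrow> \<bar>path_deriv q z\<bar> \<le> B * p z"
    using path_deriv_bound[OF tame] q0 by metis
  note [measurable] = path_deriv_measurable[OF tame] path_deriv_measurable[OF tame_weight[OF tame]]
  have "((\<lambda>\<epsilon>. \<integral>z. snd (snd z) * weight (q \<epsilon>) z \<partial>M) has_real_derivative
      (\<integral>z. snd (snd z) * path_deriv (\<lambda>\<epsilon>. weight (q \<epsilon>)) z \<partial>M)) (at 0)"
    by (rule tame_path_integral_has_derivative[OF tame_weight[OF tame]])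
      (use mean_finite q0 in auto)
  also have "(\<integral>z. snd (snd z) * path_deriv (\<lambda>\<epsilon>. weight (q \<epsilon>)) z \<partial>M) =
      (\<integral>z. snd (snd z) * weight_variation (path_deriv q) z \<partial>M)"
  proof (rule integral_cong_AE)
    show "AE z in M. snd (snd z) * path_deriv (\<lambda>\<epsilon>. weight (q \<epsilon>)) z =
        snd (snd z) * weight_variation (path_deriv q) z"
      using AE_M_LA[OF path_deriv_dens_LA] AE_M_LA[OF LA.AE_fst[OF path_deriv_dens_L]]
        AE_M_LA[OF LA.AE_snd[OF path_deriv_dens_A]] AE_space
    proof eventually_elim
      case (elim z)
      then show ?case
        unfolding path_deriv_weight[OF tame elim(4)] q0 weight_variation_def
        by (simp only: fst_conv snd_conv)
    qed
  qed measurable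
  also have "\<dots> = (\<integral>z. path_deriv q z * gradient z \<partial>M)"
    by (rule gradient_identity[OF path_deriv_measurable[OF tame] B])
  finally show ?thesis .
qed

end

text \<open>Euler's identity: in direction p, three terms of the variation each reproduce
  \<open>weight p\<close> and the denominator removes one, leaving 2.\<close>

lemma gradient_mean: "(\<integral>z. p z * gradient z \<partial>M) = 2 * psi NL AA NY p"
proof -
  have "(\<integral>z. p z * gradient z \<partial>M) = (\<integral>z. snd (snd z) * weight_variation p z \<partial>M)"
    by (rule gradient_identity[of p 1, symmetric]) (auto simp: p_nonneg)
  also have "\<dots> = (\<integral>z. 2 * (snd (snd z) * weight p z) \<partial>M)"
  proof (rule integral_cong_AE)
    have "AE z in M. dens_A p (fst (snd z)) = (\<integral>l. dens_LA p (l, fst (snd z)) \<partial>NL)"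
      using AE_M_LA[OF LA.AE_snd[OF dens_A_AE[OF p]]] by simp
    then show "AE z in M. snd (snd z) * weight_variation p z = 2 * (snd (snd z) * weight p z)"
    proof eventually_elim
      case (elim z)
      have "weight_variation p z = 2 * weight p z"
        unfolding weight_variation_def weight_def elim[symmetric]
        by (cases "dens_LA p (fst z, fst (snd z)) = 0") simp_all
      then show ?case by simp
    qed
  qed (auto simp: weight_def)
  finally show ?thesis using psi_eq[OF p mean_finite] by simp
qed

end

section \<open>Scores of parametric submodels\<close>

text \<open>A submodel passes through \<open>p\<close> on the space of \<open>M\<close> only; its extension by \<open>p\<close> does so as an
  equality of functions.\<close>

definition submodel_path :: "'z measure \<Rightarrow> ('z \<Rightarrow> real) \<Rightarrow> (real \<Rightarrow> 'z \<Rightarrow> real) \<Rightarrow> real \<Rightarrow> 'z \<Rightarrow> real" where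
  "submodel_path M p q \<epsilon> z = (if z \<in> space M then q \<epsilon> z else p z)"

lemma submodel_path_0:
  assumes "parametric_submodel M p q"
  shows "submodel_path M p q 0 = p"
  using assms by (auto simp: submodel_path_def parametric_submodel_def)

lemma tame_submodel_path:
  assumes p: "prob_density M p" and q: "parametric_submodel M p q"
  shows "tame_path M (submodel_path M p q)"
proof -
  obtain \<delta> B where \<delta>: "\<delta> > 0" and
    b: "\<And>\<epsilon>. \<bar>\<epsilon>\<bar> < \<delta> \<Longrightarrow> prob_density M (q \<epsilon>) \<and> (\<forall>z\<in>space M. \<bar>q \<epsilon> z - p z\<bar> \<le> B * \<bar>\<epsilon>\<bar> * p z)"
    using q unfolding parametric_submodel_def by blast
  have nn: "0 \<le> p z" if "z \<in> space M" for z using p that by (simp add: prob_density_def)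
  show ?thesis
  \<comment> \<open>\<open>parametric_submodel\<close> prescribes no sign for its constant, hence
    the absolute value.\<close>
  proof (rule tame_pathI[where B = "\<bar>B\<bar>"])
    show "0 \<le> submodel_path M p q 0 z" if "z \<in> space M" for z
      using nn[OF that] submodel_path_0[OF q] by simp
    show "(\<lambda>\<epsilon>. submodel_path M p q \<epsilon> z) differentiable (at 0)" if "z \<in> space M" for z
      using q that by (simp add: submodel_path_def parametric_submodel_def)
    show "\<forall>\<^sub>F \<epsilon> in nhds 0. submodel_path M p q \<epsilon> \<in> borel_measurable M \<and>
      (\<forall>z\<in>space M. \<bar>submodel_path M p q \<epsilon> z - submodel_path M p q 0 z\<bar> \<le>
          \<bar>B\<bar> * \<bar>\<epsilon>\<bar> * submodel_path M p q 0 z)"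
      using eventually_abs_small[OF \<delta>]
    proof eventually_elim
      case (elim \<epsilon>)
      have "q \<epsilon> \<in> borel_measurable M" using b[OF elim] by (simp add: prob_density_def)
      then have "submodel_path M p q \<epsilon> \<in> borel_measurable M"
        by (subst measurable_cong[of M _ "q \<epsilon>"]) (auto simp: submodel_path_def)
      moreover have "\<bar>q \<epsilon> z - p z\<bar> \<le> \<bar>B\<bar> * \<bar>\<epsilon>\<bar> * p z" if z: "z \<in> space M" for z
      proof -
        have "\<bar>q \<epsilon> z - p z\<bar> \<le> B * \<bar>\<epsilon>\<bar> * p z" using b[OF elim] z by blast
        also have "\<dots> \<le> \<bar>B\<bar> * \<bar>\<epsilon>\<bar> * p z" using nn[OF z] by (intro mult_right_mono) auto
        finally show ?thesis .
      qed
      ultimately show ?case unfolding submodel_path_0[OF q] by (simp add: submodel_path_def)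
    qed
  qed simp
qed

lemma eventually_prob_density:
  assumes "parametric_submodel M p q"
  shows "\<forall>\<^sub>F \<epsilon> in nhds 0. prob_density M (q \<epsilon>)"
proof -
  obtain \<delta> where \<delta>: "\<delta> > 0" and b: "\<And>\<epsilon>. \<bar>\<epsilon>\<bar> < \<delta> \<Longrightarrow> prob_density M (q \<epsilon>)"
    using assms unfolding parametric_submodel_def by blast
  show ?thesis using eventually_abs_small[OF \<delta>] by eventually_elim (rule b)
qed

text \<open>At a zero of p the path is 0 for all small \<epsilon>, so its logarithm is locally
  constant and the score is 0, in agreement with division by zero. Both identities thus hold at
  every point of the space.\<close>

lemma score_eq:
  assumes p: "prob_density M p" and q: "parametric_submodel M p q" and z: "z \<in> space M"
  shows "score q z = path_deriv (submodel_path M p q) z / p z"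
    and "p z * score q z = path_deriv (submodel_path M p q) z"
proof -
  note t = tame_submodel_path[OF p q] and q0 = submodel_path_0[OF q]
  have "score q z = path_deriv (submodel_path M p q) z / p z \<and>
    p z * score q z = path_deriv (submodel_path M p q) z"
  proof (cases "p z = 0")
    case True
    have e: "\<forall>\<^sub>F \<epsilon> in nhds 0. submodel_path M p q \<epsilon> z = 0"
      using tame_path_eventually_zero[OF t z] True q0 by simp
    then have "\<forall>\<^sub>F \<epsilon> in nhds 0. ln (q \<epsilon> z) = ln 0"
      using z by (auto elim!: eventually_mono simp: submodel_path_def)
    from DERIV_cong_ev[OF refl this refl] have "((\<lambda>\<epsilon>. ln (q \<epsilon> z)) has_real_derivative 0) (at 0)"
      by simp
    then have "score q z = 0" unfolding score_def by (rule DERIV_imp_deriv)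
    then show ?thesis using True path_deriv_eq_0[of "submodel_path M p q" z, OF e] by simp
  next
    case False
    then have pos: "0 < p z" using p z by (simp add: prob_density_def order_less_le)
    have pos': "0 < submodel_path M p q 0 z" using pos q0 by simp
    have "((\<lambda>\<epsilon>. ln (submodel_path M p q \<epsilon> z)) has_real_derivative
        path_deriv (submodel_path M p q) z / submodel_path M p q 0 z) (at 0)"
      using pos' by (auto intro!: derivative_eq_intros tame_path_has_deriv[OF t z])
    then have "((\<lambda>\<epsilon>. ln (q \<epsilon> z)) has_real_derivative path_deriv (submodel_path M p q) z / p z) (at 0)"
      using z q0 by (simp add: submodel_path_def)
    then have "score q z = path_deriv (submodel_path M p q) z / p z"
      unfolding score_def by (rule DERIV_imp_deriv)
    then show ?thesis using pos by simp
  qed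
  then show "score q z = path_deriv (submodel_path M p q) z / p z"
    and "p z * score q z = path_deriv (submodel_path M p q) z" by auto
qed

lemma score_measurable:
  assumes p: "prob_density M p" and q: "parametric_submodel M p q"
  shows "score q \<in> borel_measurable M"
proof -
  note [measurable] = path_deriv_measurable[OF tame_submodel_path[OF p q]]
  have [measurable]: "p \<in> borel_measurable M" using p by (simp add: prob_density_def)
  have "(\<lambda>z. path_deriv (submodel_path M p q) z / p z) \<in> borel_measurable M"
    by measurable
  then show ?thesis
    by (subst measurable_cong[OF score_eq(1)[OF p q]])
qed

text \<open>Total mass is constantly 1 near 0, so its derivative vanishes: scores have mean zero.
  Hence an influence function is not changed by a constant until its own mean is fixed.\<close>

lemma integral_path_deriv_submodel:
  assumes p: "prob_density M p" and q: "parametric_submodel M p q"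
  shows "(\<integral>z. path_deriv (submodel_path M p q) z \<partial>M) = 0"
proof -
  have "((\<lambda>\<epsilon>. \<integral>z. 1 * submodel_path M p q \<epsilon> z \<partial>M) has_real_derivative
      (\<integral>z. 1 * path_deriv (submodel_path M p q) z \<partial>M)) (at 0)"
    by (rule tame_path_integral_has_derivative[OF tame_submodel_path[OF p q]])
      (use prob_density_integrable[OF p] submodel_path_0[OF q] in auto)
  moreover have ev: "\<forall>\<^sub>F \<epsilon> in nhds 0. (\<integral>z. 1 * submodel_path M p q \<epsilon> z \<partial>M) = 1"
    using eventually_prob_density[OF q]
  proof eventually_elim
    case (elim \<epsilon>)
    have "(\<integral>z. 1 * submodel_path M p q \<epsilon> z \<partial>M) = (\<integral>z. q \<epsilon> z \<partial>M)"
      by (intro Bochner_Integration.integral_cong) (auto simp: submodel_path_def)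
    then show ?case using prob_density_integrable(2)[OF elim] by simp
  qed
  ultimately have "((\<lambda>\<epsilon>. 1) has_real_derivative (\<integral>z. 1 * path_deriv (submodel_path M p q) z \<partial>M)) (at 0)"
    by (simp only: DERIV_cong_ev[OF refl ev refl])
  from DERIV_unique[OF this DERIV_const] show ?thesis by simp
qed

lemma prob_space_law:
  assumes "prob_density M p"
  shows "prob_space (law M p)"
proof
  have "p \<in> borel_measurable M" using assms by (simp add: prob_density_def)
  then show "emeasure (law M p) (space (law M p)) = 1"
    using assms unfolding law_def prob_density_def
    by (subst emeasure_density) (auto cong: nn_integral_cong simp: indicator_def)
qed

text \<open>Bounded mean-zero functions are scores, and the centred sign of the difference of two
  influence functions is one of them.\<close>

lemma influence_function_unique:
  assumes p: "prob_density M p"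
    and f: "influence_function M p \<Psi> f" and g: "influence_function M p \<Psi> g"
  shows "AE z in law M p. g z = f z"
proof -
  let ?P = "law M p"
  interpret P: prob_space ?P by (rule prob_space_law[OF p])
  have [measurable_cong]: "sets ?P = sets M" by (simp add: law_def)
  have pm [measurable]: "p \<in> borel_measurable M" using p by (simp add: prob_density_def)
  have fi: "integrable ?P f" "(\<integral>z. f z \<partial>?P) = 0" and gi: "integrable ?P g" "(\<integral>z. g z \<partial>?P) = 0"
    using f g by (auto simp: influence_function_def)
  have [measurable]: "f \<in> borel_measurable M" "g \<in> borel_measurable M"
    using borel_measurable_integrable[OF fi(1)] borel_measurable_integrable[OF gi(1)] by auto
  define d where "d z = g z - f z" for z
  define s where "s = (\<integral>z. sgn (d z) \<partial>?P)"
  define b where "b z = sgn (d z) - s" for z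
  have [measurable]: "d \<in> borel_measurable M" "b \<in> borel_measurable M"
    unfolding d_def b_def by measurable
  have di: "integrable ?P d" "(\<integral>z. d z \<partial>?P) = 0"
    unfolding d_def using fi gi by auto
  have si: "integrable ?P (\<lambda>z. sgn (d z))"
    by (rule P.integrable_const_bound[where B = 1]) (auto simp: sgn_if)
  have s1: "\<bar>s\<bar> \<le> 1"
  proof -
    have "\<bar>s\<bar> \<le> (\<integral>z. \<bar>sgn (d z)\<bar> \<partial>?P)" unfolding s_def by (rule integral_abs_bound)
    also have "\<dots> \<le> (\<integral>z. 1 \<partial>?P)" using si by (intro integral_mono) (auto simp: sgn_if)
    finally show ?thesis by (simp add: P.prob_space)
  qed
  \<comment> \<open>The sign and its mean are each at most 1 in absolute value, so b is at most 2; 3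
    provides the strict bound of \<open>linear_parametric_submodel\<close>.\<close>
  have b3: "\<bar>b z\<bar> < 3" for z using s1 by (auto simp: b_def sgn_if)
  have b0: "(\<integral>z. b z \<partial>?P) = 0"
    unfolding b_def using si by (simp add: s_def P.prob_space)
  let ?q = "\<lambda>\<epsilon> z. (1 + \<epsilon> * b z) * p z"
  have q: "parametric_submodel M p ?q"
    by (rule linear_parametric_submodel[OF p _ b3 _ b0]) auto
  note [measurable] = score_measurable[OF p q]
  \<comment> \<open>The score of the linear path is known only where p is positive, which is almost
    everywhere under the law.\<close>
  have pos: "AE z in ?P. 0 < p z"
    unfolding law_def by (subst AE_density) auto
  have eq: "(\<integral>z. h z * score ?q z \<partial>?P) = (\<integral>z. h z * b z \<partial>?P)"
    if [measurable]: "h \<in> borel_measurable M" for h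
    using pos by (intro integral_cong_AE) (auto elim!: eventually_mono simp: score_linear)
  have "(\<integral>z. g z * score ?q z \<partial>?P) = (\<integral>z. f z * score ?q z \<partial>?P)"
    using f g q unfolding influence_function_def by (blast intro: DERIV_unique)
  then have fg: "(\<integral>z. g z * b z \<partial>?P) = (\<integral>z. f z * b z \<partial>?P)"
    by (simp add: eq)
  have bi: "integrable ?P (\<lambda>z. h z * b z)" if h: "integrable ?P h" for h
  proof (rule Bochner_Integration.integrable_bound[of _ "\<lambda>z. 3 * h z"])
    show "AE z in ?P. norm (h z * b z) \<le> norm (3 * h z)"
    proof (rule AE_I2)
      show "norm (h z * b z) \<le> norm (3 * h z)" for z
        using mult_right_mono[OF less_imp_le[OF b3[of z]] abs_ge_zero[of "h z"]]
        by (simp add: abs_mult mult.commute)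
    qed
  qed (use h in auto)
  \<comment> \<open>Both influence functions give the same derivative along this path, so d is
    orthogonal to b. As d has mean zero, the centring drops out and the integral of \<bar>d\<bar>
    remains.\<close>
  have "0 = (\<integral>z. d z * b z \<partial>?P)"
    using fg bi[OF fi(1)] bi[OF gi(1)] by (simp add: d_def left_diff_distrib)
  also have "\<dots> = (\<integral>z. \<bar>d z\<bar> - d z * s \<partial>?P)"
    by (intro Bochner_Integration.integral_cong) (auto simp: b_def sgn_if algebra_simps)
  also have "\<dots> = (\<integral>z. \<bar>d z\<bar> \<partial>?P)"
    using di by simp
  finally have "AE z in ?P. \<bar>d z\<bar> = 0"
    using di(1) by (subst (asm) eq_commute, subst (asm) integral_nonneg_eq_0_iff_AE) auto
  then show ?thesis by eventually_elim (simp add: d_def)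
qed

section \<open>The influence function of the parameter\<close>

text \<open>By Tonelli, the iterated integral of conditional densities is the integral of the
  absolute value of the outcome times \<open>weight\<close>.\<close>

lemma (in observation_space) mean_finiteI:
  assumes q: "prob_density M q"
    and fin: "(\<integral>\<^sup>+ a. (\<integral>\<^sup>+ l. (\<integral>\<^sup>+ y. ennreal (\<bar>y\<bar> * outcome_density NY q l a y *
        marginal_treatment_density NL AA NY q a) \<partial>NY) \<partial>covariate_law NL AA NY q) \<partial>\<alpha>) < \<infinity>"
  shows "integrable M (\<lambda>z. snd (snd z) * weight q z)"
proof (rule integrableI_bounded)
  have qm [measurable]: "q \<in> borel_measurable M" and nn: "\<And>z. z \<in> space M \<Longrightarrow> 0 \<le> q z"
    using q by (auto simp: prob_density_def)
  have [measurable]: "q \<in> borel_measurable (NL \<Otimes>\<^sub>M (\<alpha> \<Otimes>\<^sub>M NY))"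
    using qm by (simp add: dominating_def)
  show wm [measurable]: "(\<lambda>z. snd (snd z) * weight q z) \<in> borel_measurable M"
    unfolding weight_def by measurable
  let ?h = "\<lambda>x. \<integral>\<^sup>+ y. ennreal (\<bar>y\<bar> * (q (fst x, snd x, y) / dens_LA q x) * dens_A q (snd x)) \<partial>NY"
  have hm: "?h \<in> borel_measurable LA" by measurable
  have "(\<integral>\<^sup>+ z. ennreal (norm (snd (snd z) * weight q z)) \<partial>M) =
      (\<integral>\<^sup>+ x. \<integral>\<^sup>+ y. ennreal (norm (y * weight q (fst x, snd x, y))) \<partial>NY \<partial>LA)"
    by (subst nn_integral_M) auto
  also have "\<dots> = (\<integral>\<^sup>+ x. ennreal (dens_L q (fst x)) * ?h x \<partial>LA)"
  proof (rule nn_integral_cong)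
    fix x assume x: "x \<in> space LA"
    have l: "fst x \<in> space NL" and a: "snd x \<in> AA"
      using x by (auto simp: space_pair_measure space_restrict_space)
    have Fx: "0 \<le> dens_LA q x" using dens_LA_nonneg[of q "fst x" "snd x"] nn l a by simp
    have [measurable]: "(\<lambda>y. q (fst x, snd x, y)) \<in> borel_measurable NY"
      using x by (auto simp: space_pair_measure)
    have "ennreal (norm (y * weight q (fst x, snd x, y))) =
        ennreal (dens_L q (fst x)) * ennreal (\<bar>y\<bar> * (q (fst x, snd x, y) / dens_LA q x) * dens_A q (snd x))" for y
      using dens_L_nonneg[OF nn l] dens_A_nonneg[OF nn a] Fx nn[of "(fst x, snd x, y)"] l a
      by (subst ennreal_mult[symmetric]) (auto simp: weight_def abs_mult space_M mult_ac)
    then show "(\<integral>\<^sup>+ y. ennreal (norm (y * weight q (fst x, snd x, y))) \<partial>NY) =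
        ennreal (dens_L q (fst x)) * ?h x"
      by (simp only:) (subst nn_integral_cmult, auto)
  qed
  also have "\<dots> = (\<integral>\<^sup>+ a. \<integral>\<^sup>+ l. ennreal (dens_L q l) * ?h (l, a) \<partial>NL \<partial>\<alpha>)"
    by (subst LA.nn_integral_snd[symmetric]) auto
  also have "\<dots> = (\<integral>\<^sup>+ a. (\<integral>\<^sup>+ l. (\<integral>\<^sup>+ y. ennreal (\<bar>y\<bar> * outcome_density NY q l a y *
        marginal_treatment_density NL AA NY q a) \<partial>NY) \<partial>covariate_law NL AA NY q) \<partial>\<alpha>)"
  proof (rule nn_integral_cong)
    fix a assume a': "a \<in> space \<alpha>"
    then have a: "a \<in> AA" by (simp add: space_restrict_space)
    have sec: "(\<lambda>l. ?h (l, a)) \<in> borel_measurable NL"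
      by (rule measurable_compose[OF measurable_Pair2'[OF a'] hm])
    have dens: "outcome_density NY q l a y = q (l, a, y) / dens_LA q (l, a)" for l y
      by (simp add: outcome_density_def dens_LA_def)
    have Gm: "(\<lambda>l. ennreal (dens_L q l)) \<in> borel_measurable NL" by measurable
    show "(\<integral>\<^sup>+ l. ennreal (dens_L q l) * ?h (l, a) \<partial>NL) =
      (\<integral>\<^sup>+ l. (\<integral>\<^sup>+ y. ennreal (\<bar>y\<bar> * outcome_density NY q l a y *
        marginal_treatment_density NL AA NY q a) \<partial>NY) \<partial>covariate_law NL AA NY q)"
      unfolding covariate_law_eq[OF q] marginal_treatment_density_eq[OF q a] dens
      using nn_integral_density[OF Gm sec, symmetric] by (simp only: fst_conv snd_conv)
  qed
  also have "\<dots> < \<infinity>" by (rule fin)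
  finally show "(\<integral>\<^sup>+ z. ennreal (norm (snd (snd z) * weight q z)) \<partial>M) < \<infinity>" .
qed

section \<open>Centring the gradient\<close>

context observation
begin

lemma psi_path_derivative:
  assumes q: "parametric_submodel M p q"
  shows "((\<lambda>\<epsilon>. psi NL AA NY (q \<epsilon>)) has_real_derivative
    (\<integral>z. path_deriv (submodel_path M p q) z * gradient z \<partial>M)) (at 0)"
proof -
  let ?q = "submodel_path M p q"
  note t = tame_submodel_path[OF p q] and q0 = submodel_path_0[OF q]
  obtain B where B: "B \<ge> 0" "\<forall>\<^sub>F \<epsilon> in nhds 0. weight (?q \<epsilon>) \<in> borel_measurable M \<and>
      (\<forall>z\<in>space M. \<bar>weight (?q \<epsilon>) z - weight (?q 0) z\<bar> \<le> B * \<bar>\<epsilon>\<bar> * weight (?q 0) z)"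
    using tame_weight[OF t] by (rule tame_pathE)
  have "\<forall>\<^sub>F \<epsilon> in nhds 0. psi NL AA NY (q \<epsilon>) = (\<integral>z. snd (snd z) * weight (?q \<epsilon>) z \<partial>M)"
    using B(2) eventually_lipschitz_small[OF B(1)] eventually_prob_density[OF q]
  proof eventually_elim
    case (elim \<epsilon>)
    have w: "weight (?q \<epsilon>) z = weight (q \<epsilon>) z" if "z \<in> space M" for z
      by (rule weight_cong[OF _ that]) (simp add: submodel_path_def)
    \<comment> \<open>\<open>psi_eq\<close> needs a finite mean at each nearby density. The relative
      bound makes \<open>weight (?q \<epsilon>)\<close> at most twice \<open>weight p\<close>, so
      finiteness at p suffices.\<close>
    have i: "integrable M (\<lambda>z. snd (snd z) * weight (?q \<epsilon>) z)"
    proof (rule Bochner_Integration.integrable_bound)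
      show "integrable M (\<lambda>z. 2 * (snd (snd z) * weight p z))" using mean_finite by simp
      show "(\<lambda>z. snd (snd z) * weight (?q \<epsilon>) z) \<in> borel_measurable M"
        using elim by auto
      show "AE z in M. norm (snd (snd z) * weight (?q \<epsilon>) z) \<le> norm (2 * (snd (snd z) * weight p z))"
      proof (rule AE_I2)
        fix z assume z: "z \<in> space M"
        have "\<bar>weight (?q \<epsilon>) z - weight p z\<bar> \<le> B * \<bar>\<epsilon>\<bar> * weight p z"
          using elim z q0 by simp
        also have "\<dots> \<le> 1 / 2 * weight p z"
          using elim weight_nonneg[OF z] by (intro mult_right_mono) auto
        finally have "\<bar>weight (?q \<epsilon>) z\<bar> \<le> \<bar>2 * weight p z\<bar>"
          using weight_nonneg[OF z] by linarith
        from mult_left_mono[OF this abs_ge_zero[of "snd (snd z)"]]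
        show "norm (snd (snd z) * weight (?q \<epsilon>) z) \<le> norm (2 * (snd (snd z) * weight p z))"
          by (simp add: abs_mult mult_ac)
      qed
    qed
    have "integrable M (\<lambda>z. snd (snd z) * weight (q \<epsilon>) z)"
      using i by (simp add: w cong: Bochner_Integration.integrable_cong)
    then have "psi NL AA NY (q \<epsilon>) = (\<integral>z. snd (snd z) * weight (q \<epsilon>) z \<partial>M)"
      by (rule psi_eq[OF elim(3)])
    also have "\<dots> = (\<integral>z. snd (snd z) * weight (?q \<epsilon>) z \<partial>M)"
      by (intro Bochner_Integration.integral_cong) (auto simp: w)
    finally show ?case .
  qed
  from DERIV_cong_ev[OF refl this refl] weight_integral_has_derivative[OF t q0]
  show ?thesis by blast
qed

text \<open>The difference stays inside the last integral, as in the claim. Splitting it requires an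
  integrable section, which is available only almost surely.\<close>

definition eif :: "'l \<times> real \<times> real \<Rightarrow> real" where
  "eif z = (snd (snd z) - mean p (fst z, fst (snd z))) * ratio (fst z, fst (snd z))
     + mean_A (fst (snd z)) - psi NL AA NY p
     + (\<integral>a. (mean p (fst z, a) - mean_A a) * dens_A p a \<partial>\<alpha>)"

lemma eif_measurable [measurable]: "eif \<in> borel_measurable M"
proof -
  have [measurable]: "(\<lambda>l. \<integral>a. (mean p (l, a) - mean_A a) * dens_A p a \<partial>\<alpha>) \<in> borel_measurable NL"
    by measurable
  have [measurable]: "(\<lambda>z. \<integral>a. (mean p (fst z, a) - mean_A a) * dens_A p a \<partial>\<alpha>) \<in> borel_measurable M"
    by (rule measurable_compose[of fst M NL]) measurable
  show ?thesis unfolding eif_def by measurable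
qed

lemma eif_eq:
  "AE z in law M p. eif z = gradient z - 2 * psi NL AA NY p"
proof -
  have "integrable LA (\<lambda>x. (mean p x * dens_A p (snd x)) * dens_L p (fst x))"
    using mean_weighted_integrable(1) by (simp only: mult_ac)
  from LA.AE_integrable_fst'[OF this]
  \<comment> \<open>Fubini gives integrability of the section multiplied by
    \<open>dens_L p l\<close>; this factor can be removed only where it is positive, that is, for
    almost every l under the covariate law.\<close>
  have "AE l in NL. 0 < ennreal (dens_L p l) \<longrightarrow> integrable \<alpha> (\<lambda>a. mean p (l, a) * dens_A p a)"
    by eventually_elim auto
  then have "AE l in density NL (\<lambda>l. ennreal (dens_L p l)). integrable \<alpha> (\<lambda>a. mean p (l, a) * dens_A p a)"
    by (subst AE_density) auto
  then have "AE l in distr (law M p) NL fst. integrable \<alpha> (\<lambda>a. mean p (l, a) * dens_A p a)"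
    by (simp only: covariate_law_eq[OF p, unfolded covariate_law_def])
  then have "AE z in law M p. integrable \<alpha> (\<lambda>a. mean p (fst z, a) * dens_A p a)"
    by (rule AE_distrD[rotated]) measurable
  then show ?thesis
  proof eventually_elim
    case (elim z)
    have "(\<integral>a. (mean p (fst z, a) - mean_A a) * dens_A p a \<partial>\<alpha>) =
        (\<integral>a. mean p (fst z, a) * dens_A p a - dens_A p a * mean_A a \<partial>\<alpha>)"
      by (intro Bochner_Integration.integral_cong) (auto simp: algebra_simps)
    also have "\<dots> = mean_L (fst z) - psi NL AA NY p"
      using Bochner_Integration.integral_diff[OF elim dens_A_mean_A_integrable(1)]
      by (simp add: mean_L_def dens_A_mean_A_integrable(2))
    finally show ?case by (simp add: eif_def gradient_def left_diff_distrib)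
  qed
qed

lemma eif_integrable: "integrable (law M p) eif"
proof -
  interpret P: prob_space "law M p" by (rule prob_space_law[OF p])
  have i: "integrable (law M p) (\<lambda>z. gradient z - 2 * psi NL AA NY p)"
    using gradient_integrable by auto
  show ?thesis
    by (rule integrable_cong_AE_imp[OF i]) (use eif_eq in \<open>auto elim!: eventually_mono\<close>)
qed

text \<open>Stated for any s with p s = c to serve twice: the score of a submodel, where c has
  integral 0 and the constant disappears, and s = 1 with c = p, where it gives mean 2 \<psi> - 2
  \<psi> = 0.\<close>

lemma eif_score_integral:
  assumes cm [measurable]: "c \<in> borel_measurable M" and B: "B \<ge> 0"
    and c: "\<And>z. z \<in> space M \<Longrightarrow> \<bar>c z\<bar> \<le> B * p z"
    and [measurable]: "s \<in> borel_measurable M" and s: "\<And>z. z \<in> space M \<Longrightarrow> p z * s z = c z"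
  shows "(\<integral>z. eif z * s z \<partial>law M p) =
    (\<integral>z. c z * gradient z \<partial>M) - 2 * psi NL AA NY p * (\<integral>z. c z \<partial>M)"
proof -
  have pn: "AE z in M. 0 \<le> p z" using p_nonneg by auto
  have "(\<integral>z. eif z * s z \<partial>law M p) = (\<integral>z. (gradient z - 2 * psi NL AA NY p) * s z \<partial>law M p)"
    using eif_eq by (intro integral_cong_AE) (auto elim!: eventually_mono)
  also have "\<dots> = (\<integral>z. p z * ((gradient z - 2 * psi NL AA NY p) * s z) \<partial>M)"
    unfolding law_def using pn by (subst integral_density) auto
  also have "\<dots> = (\<integral>z. c z * gradient z - 2 * psi NL AA NY p * c z \<partial>M)"
    by (intro Bochner_Integration.integral_cong) (auto simp flip: s simp: algebra_simps)
  also have "\<dots> = (\<integral>z. c z * gradient z \<partial>M) - 2 * psi NL AA NY p * (\<integral>z. c z \<partial>M)"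
    using integrable_of_law[OF gradient_integrable cm c] c_integrable[OF cm B c] by simp
  finally show ?thesis .
qed

lemma eif_influence_function: "influence_function M p (psi NL AA NY) eif"
  unfolding influence_function_def
proof (intro conjI allI impI)
  show "integrable (law M p) eif" by (rule eif_integrable)
  show "(\<integral>z. eif z \<partial>law M p) = 0"
    using eif_score_integral[of p 1 "\<lambda>_. 1"] gradient_mean p_integrable(2) p_nonneg by simp
next
  fix q assume q: "parametric_submodel M p q"
  let ?c = "path_deriv (submodel_path M p q)"
  obtain B where B: "B \<ge> 0" "\<And>z. z \<in> space M \<Longrightarrow> \<bar>?c z\<bar> \<le> B * p z"
    using path_deriv_bound[OF tame_submodel_path[OF p q]] submodel_path_0[OF q] by metis
  have "(\<integral>z. eif z * score q z \<partial>law M p) = (\<integral>z. ?c z * gradient z \<partial>M)"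
    using eif_score_integral[OF path_deriv_measurable[OF tame_submodel_path[OF p q]] B
        score_measurable[OF p q] score_eq(2)[OF p q]]
    by (simp only: integral_path_deriv_submodel[OF p q] mult_zero_right diff_zero)
  then show "((\<lambda>\<epsilon>. psi NL AA NY (q \<epsilon>)) has_real_derivative
      (\<integral>z. eif z * score q z \<partial>law M p)) (at 0)"
    using psi_path_derivative[OF q] by simp
qed

text \<open>The identity is pointwise because \<open>dens_A\<close> was chosen to equal the defined
  treatment marginal at every point of \<open>AA\<close>.\<close>

lemma eif_expand:
  assumes "l \<in> space NL" "a \<in> AA"
  shows "eif (l, a, y) =
    xi (covariate_law NL AA NY p) (treatment_density AA NY p) (outcome_mean NY p) (l, a, y)
    - psi NL AA NY p
    + (\<integral>a'. (outcome_mean NY p l a' - (\<integral>l'. outcome_mean NY p l' a' \<partial>covariate_law NL AA NY p))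
        * marginal_treatment_density NL AA NY p a' \<partial>\<alpha>)"
proof -
  have mA: "(\<integral>l'. mean p (l', a') \<partial>covariate_law NL AA NY p) = mean_A a'" if "a' \<in> AA" for a'
    using covariate_integral[OF p measurable_section[OF mean_measurable[OF p_measurable] that]]
    by (simp only: mean_A_def mult.commute)
  have tA: "(\<integral>l'. dens_LA p (l', a) / dens_L p l' \<partial>covariate_law NL AA NY p) = dens_A p a"
    using marginal_treatment_density_eq[OF p assms(2)] by (simp add: marginal_treatment_density_def treatment_density_eq)
  have "(\<integral>a'. (outcome_mean NY p l a' - (\<integral>l'. outcome_mean NY p l' a' \<partial>covariate_law NL AA NY p))
        * marginal_treatment_density NL AA NY p a' \<partial>\<alpha>) =
      (\<integral>a'. (mean p (l, a') - mean_A a') * dens_A p a' \<partial>\<alpha>)"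
    by (intro Bochner_Integration.integral_cong)
      (auto simp: space_restrict_space mA outcome_mean_eq marginal_treatment_density_eq[OF p])
  then show ?thesis
    by (simp add: eif_def xi_def tA mA[OF assms(2)] ratio_def outcome_mean_eq
        treatment_density_eq mult_ac)
qed

end

text \<open>Bridges the remaining gap between \<open>eif\<close> and the claimed function, which are
  identified only for covariates and treatments in their spaces.\<close>

lemma influence_function_cong:
  assumes "\<And>z. z \<in> space M \<Longrightarrow> f z = g z" and f: "influence_function M p \<Psi> f"
  shows "influence_function M p \<Psi> g"
proof -
  have sp: "space (law M p) = space M" by (simp add: law_def)
  have "integrable (law M p) g \<longleftrightarrow> integrable (law M p) f"
    "(\<integral>z. g z \<partial>law M p) = (\<integral>z. f z \<partial>law M p)"
    "\<And>s. (\<integral>z. g z * s z \<partial>law M p) = (\<integral>z. f z * s z \<partial>law M p)"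
    using assms(1) by (auto intro!: Bochner_Integration.integral_cong Bochner_Integration.integrable_cong simp: sp)
  then show ?thesis using f by (simp add: influence_function_def)
qed

theorem theorem1:
  fixes NL :: "'l measure" and AA :: "real set" and NY :: "real measure"
    and p :: "'l \<times> real \<times> real \<Rightarrow> real"
  defines "M \<equiv> dominating NL AA NY"
    and "PL \<equiv> covariate_law NL AA NY p"
    and "\<pi> \<equiv> treatment_density AA NY p"
    and "\<mu> \<equiv> outcome_mean NY p"
    and "\<omega> \<equiv> marginal_treatment_density NL AA NY p"
  assumes "sigma_finite_measure NL" and "sigma_finite_measure NY"
    and "sets NY = sets borel" and "AA \<in> sets borel"
    and dens: "prob_density M p"
    and support: "AE (l, a) in PL \<Otimes>\<^sub>M leb_on AA. 0 < \<pi> l a"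
    and finite_mean: "(\<integral>\<^sup>+ a. (\<integral>\<^sup>+ l. (\<integral>\<^sup>+ y. ennreal (\<bar>y\<bar> * outcome_density NY p l a y * \<omega> a)
                          \<partial>NY) \<partial>PL) \<partial>leb_on AA) < \<infinity>"
  shows "efficient_influence_function M p (psi NL AA NY)
           (\<lambda>(l, a, y). xi PL \<pi> \<mu> (l, a, y) - psi NL AA NY p
              + (\<integral>a'. (\<mu> l a' - (\<integral>l'. \<mu> l' a' \<partial>PL)) * \<omega> a' \<partial>leb_on AA))"
    (is "efficient_influence_function M p _ ?\<phi>")
proof -
  interpret O: observation_space NL AA NY
    by (intro observation_space.intro \<open>sigma_finite_measure NL\<close> \<open>sigma_finite_measure NY\<close>
        \<open>sets NY = sets borel\<close> \<open>AA \<in> sets borel\<close>)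
  interpret O: observation NL AA NY p
  proof
    show "prob_density (dominating NL AA NY) p" using dens by (simp add: M_def)
    then show "integrable (dominating NL AA NY) (\<lambda>z. snd (snd z) * O.weight p z)"
      using finite_mean unfolding PL_def \<omega>_def by (intro O.mean_finiteI)
  qed
  have "influence_function M p (psi NL AA NY) ?\<phi>"
  proof (rule influence_function_cong)
    show "influence_function M p (psi NL AA NY) O.eif"
      unfolding M_def by (rule O.eif_influence_function)
    show "O.eif z = ?\<phi> z" if "z \<in> space M" for z
      using that O.eif_expand
      by (auto simp: M_def O.space_M PL_def \<pi>_def \<mu>_def \<omega>_def)
  qed
  then show ?thesis
    using influence_function_unique[OF dens] unfolding efficient_influence_function_def by blast
qed

end
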